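(* Let $k$ be a natural number. For any formula $\varphi\in\Pi_{k+2}$ and any formula $\psi$ of prenex normal form, if $\mathsf{PA}\vdash\psi\to\varphi$, then $\mathsf{HA}+\mathrm{LEM}(\Sigma_k)\vdash\psi\to\varphi$.
   Context: $\mathsf{HA}$ is intuitionistic (Heyting) arithmetic in the language with function symbols for all primitive recursive functions and logical constants $\forall,\exists,\to,\land,\lor,\perp$; $\neg\varphi$ abbreviates $\varphi\to\perp$. $\mathsf{PA}$ is $\mathsf{HA}$ plus the law of excluded middle for all formulas. $\Sigma_0=\Pi_0$ is the class of quantifier-free formulas; $\Pi_{k+1}$ consists of formulas $Q_1\bar x_1\cdots Q_{k+1}\bar x_{k+1}\,\varphi_{qf}$ with $\varphi_{qf}$ quantifier-free, $Q_i=\forall$ for odd $i$ and $\exists$ for even $i$; $\Sigma_{k+1}$ likewise with $Q_i=\exists$ for odd $i$ and $\forall$ for even $i$ (blocks of like quantifiers). A formula is of prenex normal form if it is in $\Sigma_k\cup\Pi_k$ for some $k$. $\Gamma(x)$ is the set of formulas in $\Gamma$ whose free variables are among $x$. $\mathrm{LEM}(\Gamma)$ is the schema $\forall x(\varphi(x)\lor\neg\varphi(x))$ for $\varphi(x)\in\Gamma(x)$, and $\mathsf{HA}+\mathrm{LEM}(\Gamma)$ is $\mathsf{HA}$ with all its instances added. *)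

theory Defs
  imports Main
begin

text \<open>Primitive recursive function symbols, one for each definition. In \<open>PComp n g hs\<close> the arity
  \<open>n\<close> of the composite is recorded explicitly, as \<open>hs\<close> may be empty. \<open>PRec g h\<close> recurses on its
  first argument.\<close>

datatype pr =
    PZero
  | PSucc
  | PProj nat nat
  | PComp nat pr "pr list"
  | PRec pr pr

primrec arity :: "pr \<Rightarrow> nat" where
  "arity PZero = 0"
| "arity PSucc = 1"
| "arity (PProj n i) = n"
| "arity (PComp n g hs) = n"
| "arity (PRec g h) = Suc (arity g)"

fun wf_pr :: "pr \<Rightarrow> bool" where
  "wf_pr PZero = True"
| "wf_pr PSucc = True"
| "wf_pr (PProj n i) = (i < n)"
| "wf_pr (PComp n g hs) =
    (wf_pr g \<and> arity g = length hs \<and> (\<forall>h \<in> set hs. wf_pr h \<and> arity h = n))"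
| "wf_pr (PRec g h) = (wf_pr g \<and> wf_pr h \<and> arity h = arity g + 2)"

text \<open>Terms and formulas use de Bruijn indices: \<open>Var i\<close> under \<open>m\<close> quantifiers is bound
  if \<open>i < m\<close>, and otherwise denotes the free variable \<open>i - m\<close>.\<close>

datatype tm = Var nat | Fn pr "tm list"

datatype fm =
    Eq tm tm
  | Fls
  | And fm fm
  | Or fm fm
  | Imp fm fm
  | All fm
  | Ex fm

abbreviation Neg :: "fm \<Rightarrow> fm" where
  "Neg \<phi> \<equiv> Imp \<phi> Fls"

abbreviation zero :: tm where
  "zero \<equiv> Fn PZero []"

abbreviation succ :: "tm \<Rightarrow> tm" where
  "succ t \<equiv> Fn PSucc [t]"

fun wf_tm :: "tm \<Rightarrow> bool" where
  "wf_tm (Var i) = True"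
| "wf_tm (Fn f ts) = (wf_pr f \<and> length ts = arity f \<and> (\<forall>t \<in> set ts. wf_tm t))"

primrec wf_fm :: "fm \<Rightarrow> bool" where
  "wf_fm (Eq s t) = (wf_tm s \<and> wf_tm t)"
| "wf_fm Fls = True"
| "wf_fm (And \<phi> \<psi>) = (wf_fm \<phi> \<and> wf_fm \<psi>)"
| "wf_fm (Or \<phi> \<psi>) = (wf_fm \<phi> \<and> wf_fm \<psi>)"
| "wf_fm (Imp \<phi> \<psi>) = (wf_fm \<phi> \<and> wf_fm \<psi>)"
| "wf_fm (All \<phi>) = wf_fm \<phi>"
| "wf_fm (Ex \<phi>) = wf_fm \<phi>"

fun fv_tm :: "tm \<Rightarrow> nat set" where
  "fv_tm (Var i) = {i}"
| "fv_tm (Fn f ts) = (\<Union>t \<in> set ts. fv_tm t)"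

primrec fv :: "fm \<Rightarrow> nat set" where
  "fv (Eq s t) = fv_tm s \<union> fv_tm t"
| "fv Fls = {}"
| "fv (And \<phi> \<psi>) = fv \<phi> \<union> fv \<psi>"
| "fv (Or \<phi> \<psi>) = fv \<phi> \<union> fv \<psi>"
| "fv (Imp \<phi> \<psi>) = fv \<phi> \<union> fv \<psi>"
| "fv (All \<phi>) = {i. Suc i \<in> fv \<phi>}"
| "fv (Ex \<phi>) = {i. Suc i \<in> fv \<phi>}"

fun subst_tm :: "(nat \<Rightarrow> tm) \<Rightarrow> tm \<Rightarrow> tm" where
  "subst_tm \<sigma> (Var i) = \<sigma> i"
| "subst_tm \<sigma> (Fn f ts) = Fn f (map (subst_tm \<sigma>) ts)"

definition up :: "(nat \<Rightarrow> tm) \<Rightarrow> nat \<Rightarrow> tm" where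
  "up \<sigma> = case_nat (Var 0) (\<lambda>i. subst_tm (\<lambda>j. Var (Suc j)) (\<sigma> i))"

primrec subst :: "(nat \<Rightarrow> tm) \<Rightarrow> fm \<Rightarrow> fm" where
  "subst \<sigma> (Eq s t) = Eq (subst_tm \<sigma> s) (subst_tm \<sigma> t)"
| "subst \<sigma> Fls = Fls"
| "subst \<sigma> (And \<phi> \<psi>) = And (subst \<sigma> \<phi>) (subst \<sigma> \<psi>)"
| "subst \<sigma> (Or \<phi> \<psi>) = Or (subst \<sigma> \<phi>) (subst \<sigma> \<psi>)"
| "subst \<sigma> (Imp \<phi> \<psi>) = Imp (subst \<sigma> \<phi>) (subst \<sigma> \<psi>)"
| "subst \<sigma> (All \<phi>) = All (subst (up \<sigma>) \<phi>)"
| "subst \<sigma> (Ex \<phi>) = Ex (subst (up \<sigma>) \<phi>)"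

definition lift :: "fm \<Rightarrow> fm" where
  "lift = subst (\<lambda>i. Var (Suc i))"

text \<open>\<open>inst t \<phi>\<close> replaces variable 0 by \<open>t\<close> and removes it from the context;
  \<open>succ_inst \<phi>\<close> replaces variable 0 by its successor and keeps it.\<close>

definition inst :: "tm \<Rightarrow> fm \<Rightarrow> fm" where
  "inst t = subst (case_nat t Var)"

definition succ_inst :: "fm \<Rightarrow> fm" where
  "succ_inst = subst (case_nat (succ (Var 0)) (\<lambda>i. Var (Suc i)))"

text \<open>Intuitionistic natural deduction over a set \<open>T\<close> of axioms. The local hypotheses \<open>\<Gamma>\<close> are subject
  to the eigenvariable conditions (expressed by lifting), the axioms are not: a free variable of an
  axiom is read as universally quantified.\<close>

inductive nd :: "fm set \<Rightarrow> fm set \<Rightarrow> fm \<Rightarrow> bool" for T :: "fm set" where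
  Axiom: "\<phi> \<in> T \<Longrightarrow> wf_fm \<phi> \<Longrightarrow> nd T \<Gamma> \<phi>"
| Hyp: "\<phi> \<in> \<Gamma> \<Longrightarrow> wf_fm \<phi> \<Longrightarrow> nd T \<Gamma> \<phi>"
| FlsE: "nd T \<Gamma> Fls \<Longrightarrow> wf_fm \<phi> \<Longrightarrow> nd T \<Gamma> \<phi>"
| AndI: "nd T \<Gamma> \<phi> \<Longrightarrow> nd T \<Gamma> \<psi> \<Longrightarrow> nd T \<Gamma> (And \<phi> \<psi>)"
| AndE1: "nd T \<Gamma> (And \<phi> \<psi>) \<Longrightarrow> nd T \<Gamma> \<phi>"
| AndE2: "nd T \<Gamma> (And \<phi> \<psi>) \<Longrightarrow> nd T \<Gamma> \<psi>"
| OrI1: "nd T \<Gamma> \<phi> \<Longrightarrow> wf_fm \<psi> \<Longrightarrow> nd T \<Gamma> (Or \<phi> \<psi>)"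
| OrI2: "nd T \<Gamma> \<psi> \<Longrightarrow> wf_fm \<phi> \<Longrightarrow> nd T \<Gamma> (Or \<phi> \<psi>)"
| OrE: "nd T \<Gamma> (Or \<phi> \<psi>) \<Longrightarrow> nd T (insert \<phi> \<Gamma>) \<chi> \<Longrightarrow> nd T (insert \<psi> \<Gamma>) \<chi> \<Longrightarrow> nd T \<Gamma> \<chi>"
| ImpI: "nd T (insert \<phi> \<Gamma>) \<psi> \<Longrightarrow> wf_fm \<phi> \<Longrightarrow> nd T \<Gamma> (Imp \<phi> \<psi>)"
| ImpE: "nd T \<Gamma> (Imp \<phi> \<psi>) \<Longrightarrow> nd T \<Gamma> \<phi> \<Longrightarrow> nd T \<Gamma> \<psi>"
| AllI: "nd T (lift ` \<Gamma>) \<phi> \<Longrightarrow> nd T \<Gamma> (All \<phi>)"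
| AllE: "nd T \<Gamma> (All \<phi>) \<Longrightarrow> wf_tm t \<Longrightarrow> nd T \<Gamma> (inst t \<phi>)"
| ExI: "nd T \<Gamma> (inst t \<phi>) \<Longrightarrow> wf_tm t \<Longrightarrow> wf_fm \<phi> \<Longrightarrow> nd T \<Gamma> (Ex \<phi>)"
| ExE: "nd T \<Gamma> (Ex \<phi>) \<Longrightarrow> nd T (insert \<phi> (lift ` \<Gamma>)) (lift \<chi>) \<Longrightarrow> wf_fm \<chi> \<Longrightarrow> nd T \<Gamma> \<chi>"

abbreviation proves :: "fm set \<Rightarrow> fm \<Rightarrow> bool" (infix \<open>\<turnstile>\<close> 50) where
  "T \<turnstile> \<phi> \<equiv> nd T {} \<phi>"

inductive_set HA :: "fm set" where
  refl: "wf_tm t \<Longrightarrow> Eq t t \<in> HA"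
| eucl: "wf_tm r \<Longrightarrow> wf_tm s \<Longrightarrow> wf_tm t \<Longrightarrow> Imp (And (Eq r s) (Eq r t)) (Eq s t) \<in> HA"
| cong: "wf_tm (Fn f (us @ s # vs)) \<Longrightarrow> wf_tm t \<Longrightarrow>
    Imp (Eq s t) (Eq (Fn f (us @ s # vs)) (Fn f (us @ t # vs))) \<in> HA"
| succ_not_zero: "wf_tm t \<Longrightarrow> Neg (Eq (succ t) zero) \<in> HA"
| succ_inj: "wf_tm s \<Longrightarrow> wf_tm t \<Longrightarrow> Imp (Eq (succ s) (succ t)) (Eq s t) \<in> HA"
| proj: "wf_tm (Fn (PProj n i) ts) \<Longrightarrow> Eq (Fn (PProj n i) ts) (ts ! i) \<in> HA"
| comp: "wf_tm (Fn (PComp n g hs) ts) \<Longrightarrow>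
    Eq (Fn (PComp n g hs) ts) (Fn g (map (\<lambda>h. Fn h ts) hs)) \<in> HA"
| rec_zero: "wf_tm (Fn (PRec g h) (zero # ts)) \<Longrightarrow>
    Eq (Fn (PRec g h) (zero # ts)) (Fn g ts) \<in> HA"
| rec_succ: "wf_tm (Fn (PRec g h) (succ t # ts)) \<Longrightarrow>
    Eq (Fn (PRec g h) (succ t # ts)) (Fn h (t # Fn (PRec g h) (t # ts) # ts)) \<in> HA"
| ind: "wf_fm \<phi> \<Longrightarrow>
    Imp (And (inst zero \<phi>) (All (Imp \<phi> (succ_inst \<phi>)))) (All \<phi>) \<in> HA"

text \<open>The variable \<open>x\<close> in \<open>\<forall>x (\<phi>(x) \<or> \<not> \<phi>(x))\<close> is read as a list of variables, of arbitrary length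
  \<open>n\<close>, containing all free variables of \<open>\<phi>\<close>.\<close>

definition LEM :: "fm set \<Rightarrow> fm set" where
  "LEM G = {(All ^^ n) (Or \<phi> (Neg \<phi>)) | n \<phi>. \<phi> \<in> G \<and> fv \<phi> \<subseteq> {..<n}}"

definition PA :: "fm set" where
  "PA = HA \<union> LEM {\<phi>. wf_fm \<phi>}"

primrec qfree :: "fm \<Rightarrow> bool" where
  "qfree (Eq s t) = True"
| "qfree Fls = True"
| "qfree (And \<phi> \<psi>) = (qfree \<phi> \<and> qfree \<psi>)"
| "qfree (Or \<phi> \<psi>) = (qfree \<phi> \<and> qfree \<psi>)"
| "qfree (Imp \<phi> \<psi>) = (qfree \<phi> \<and> qfree \<psi>)"
| "qfree (All \<phi>) = False"
| "qfree (Ex \<phi>) = False"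

text \<open>A quantifier block may be empty, so the classes are cumulative.\<close>

fun \<Sigma>_cls :: "nat \<Rightarrow> fm set" and \<Pi>_cls :: "nat \<Rightarrow> fm set" where
  "\<Sigma>_cls 0 = {\<phi>. wf_fm \<phi> \<and> qfree \<phi>}"
| "\<Sigma>_cls (Suc k) = {(Ex ^^ n) \<phi> | n \<phi>. \<phi> \<in> \<Pi>_cls k}"
| "\<Pi>_cls 0 = {\<phi>. wf_fm \<phi> \<and> qfree \<phi>}"
| "\<Pi>_cls (Suc k) = {(All ^^ n) \<phi> | n \<phi>. \<phi> \<in> \<Sigma>_cls k}"

definition prenex :: "fm \<Rightarrow> bool" where
  "prenex \<phi> \<longleftrightarrow> (\<exists>k. \<phi> \<in> \<Sigma>_cls k \<union> \<Pi>_cls k)"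

end

theory Submission
  imports Defs
begin

text \<open>Fix a formula \<open>R\<close> and let \<open>\<phi>\<^sup>R\<close> be the Goedel-Gentzen translation of \<open>\<phi>\<close> with \<open>\<bottom>\<close> replaced by
  \<open>R\<close>; then \<open>PA \<turnstile> \<phi>\<close> implies \<open>HA \<turnstile> \<phi>\<^sup>R\<close>. Since quantifier-free formulas are decidable, \<open>\<psi> \<longrightarrow> \<psi>\<^sup>R\<close> for every
  prenex \<open>\<psi>\<close>. Conversely, \<open>LEM (\<Sigma>_cls k)\<close> decides \<open>\<Pi>_cls k\<close> formulas \<open>\<theta>\<close> constructively (either \<open>\<theta>\<close> or its
  classical dual holds), which gives \<open>\<theta>\<^sup>R \<longrightarrow> (\<theta> \<longrightarrow> R) \<longrightarrow> R\<close>, and this property passes from \<open>\<theta>\<close> to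
  \<open>\<exists>x. \<theta>\<close>. Strip the leading universal quantifiers of \<open>\<phi>\<close> and take for \<open>R\<close> the remaining
  formula \<open>\<exists>x. \<theta>\<close>: then \<open>\<psi>\<close> gives \<open>\<psi>\<^sup>R\<close>, hence \<open>R\<^sup>R\<close>, hence \<open>R\<close>.\<close>

section \<open>Substitution\<close>

lemma up_simps [simp]:
  "up \<sigma> 0 = Var 0" "up \<sigma> (Suc i) = subst_tm (\<lambda>j. Var (Suc j)) (\<sigma> i)"
  by (simp_all add: up_def)

lemma subst_tm_subst_tm [simp]:
  "subst_tm \<sigma> (subst_tm \<tau> t) = subst_tm (\<lambda>i. subst_tm \<sigma> (\<tau> i)) t"
  by (induction t) auto

lemma subst_tm_Var [simp]: "subst_tm Var t = t"
  by (induction t) (auto simp: map_idI)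

lemma up_Var [simp]: "up Var = Var"
proof
  show "up Var i = Var i" for i by (cases i) auto
qed

lemma up_comp: "(\<lambda>i. subst_tm (up \<sigma>) (up \<tau> i)) = up (\<lambda>i. subst_tm \<sigma> (\<tau> i))"
proof
  show "subst_tm (up \<sigma>) (up \<tau> i) = up (\<lambda>i. subst_tm \<sigma> (\<tau> i)) i" for i by (cases i) auto
qed

lemma subst_subst [simp]:
  "subst \<sigma> (subst \<tau> \<phi>) = subst (\<lambda>i. subst_tm \<sigma> (\<tau> i)) \<phi>"
  by (induction \<phi> arbitrary: \<sigma> \<tau>) (auto simp: up_comp)

lemma subst_Var [simp]: "subst Var \<phi> = \<phi>"
  by (induction \<phi>) auto

section \<open>Free variables, closed formulas and well-formedness\<close>

lemma subst_tm_cong: "(\<And>i. i \<in> fv_tm t \<Longrightarrow> \<sigma> i = \<tau> i) \<Longrightarrow> subst_tm \<sigma> t = subst_tm \<tau> t"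
  by (induction t) auto

lemma subst_cong_fv: "(\<And>i. i \<in> fv \<phi> \<Longrightarrow> \<sigma> i = \<tau> i) \<Longrightarrow> subst \<sigma> \<phi> = subst \<tau> \<phi>"
proof (induction \<phi> arbitrary: \<sigma> \<tau>)
  case (Eq s t)
  then show ?case by (auto intro!: subst_tm_cong)
next
  case (All \<phi>)
  have "up \<sigma> i = up \<tau> i" if "i \<in> fv \<phi>" for i
    using that All.prems by (cases i) auto
  then have "subst (up \<sigma>) \<phi> = subst (up \<tau>) \<phi>" by (rule All.IH)
  then show ?case by simp
next
  case (Ex \<phi>)
  have "up \<sigma> i = up \<tau> i" if "i \<in> fv \<phi>" for i
    using that Ex.prems by (cases i) auto
  then have "subst (up \<sigma>) \<phi> = subst (up \<tau>) \<phi>" by (rule Ex.IH)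
  then show ?case by simp
next
  case (And \<phi>1 \<phi>2)
  have "subst \<sigma> \<phi>1 = subst \<tau> \<phi>1" "subst \<sigma> \<phi>2 = subst \<tau> \<phi>2"
    by (rule And.IH, simp add: And.prems)+
  then show ?case by simp
next
  case (Or \<phi>1 \<phi>2)
  have "subst \<sigma> \<phi>1 = subst \<tau> \<phi>1" "subst \<sigma> \<phi>2 = subst \<tau> \<phi>2"
    by (rule Or.IH, simp add: Or.prems)+
  then show ?case by simp
next
  case (Imp \<phi>1 \<phi>2)
  have "subst \<sigma> \<phi>1 = subst \<tau> \<phi>1" "subst \<sigma> \<phi>2 = subst \<tau> \<phi>2"
    by (rule Imp.IH, simp add: Imp.prems)+
  then show ?case by simp
qed auto

lemma subst_closed: "fv \<phi> = {} \<Longrightarrow> subst \<sigma> \<phi> = \<phi>"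
  using subst_cong_fv[of \<phi> \<sigma> Var] by simp

lemma finite_fv_tm: "finite (fv_tm t)"
  by (induction t) auto

lemma finite_fv: "finite (fv \<phi>)"
proof (induction \<phi>)
  case (All \<phi>)
  then show ?case using finite_vimageI[of "fv \<phi>" Suc] by (simp add: vimage_def)
next
  case (Ex \<phi>)
  then show ?case using finite_vimageI[of "fv \<phi>" Suc] by (simp add: vimage_def)
qed (auto simp: finite_fv_tm)

lemma fv_bounded: "\<exists>n. fv \<phi> \<subseteq> {..<n}"
  using finite_fv[of \<phi>] by (auto simp: finite_nat_set_iff_bounded)

lemma fv_All_pow: "fv ((All ^^ n) \<phi>) = {i. i + n \<in> fv \<phi>}"
  by (induction n) auto

lemma wf_subst_tm: "wf_tm t \<Longrightarrow> (\<And>i. wf_tm (\<sigma> i)) \<Longrightarrow> wf_tm (subst_tm \<sigma> t)"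
  by (induction t) auto

lemma wf_up: "(\<And>i. wf_tm (\<sigma> i)) \<Longrightarrow> wf_tm (up \<sigma> i)"
  by (cases i) (auto intro: wf_subst_tm)

lemma wf_subst: "wf_fm \<phi> \<Longrightarrow> (\<And>i. wf_tm (\<sigma> i)) \<Longrightarrow> wf_fm (subst \<sigma> \<phi>)"
  by (induction \<phi> arbitrary: \<sigma>) (auto intro: wf_subst_tm wf_up)

lemma wf_lift [simp]: "wf_fm \<phi> \<Longrightarrow> wf_fm (lift \<phi>)"
  by (simp add: lift_def wf_subst)

lemma wf_inst: "wf_fm \<phi> \<Longrightarrow> wf_tm t \<Longrightarrow> wf_fm (inst t \<phi>)"
  unfolding inst_def by (rule wf_subst) (auto split: nat.split)

lemma lift_simps [simp]:
  "lift Fls = Fls"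
  "lift (And \<phi> \<psi>) = And (lift \<phi>) (lift \<psi>)"
  "lift (Or \<phi> \<psi>) = Or (lift \<phi>) (lift \<psi>)"
  "lift (Imp \<phi> \<psi>) = Imp (lift \<phi>) (lift \<psi>)"
  by (simp_all add: lift_def)

lemma subst_up_lift: "subst (up \<sigma>) (lift \<phi>) = lift (subst \<sigma> \<phi>)"
  by (simp add: lift_def)

lemma inst_lift [simp]: "inst t (lift \<phi>) = \<phi>"
  by (simp add: inst_def lift_def)

lemma succ_inst_lift [simp]: "succ_inst (lift \<phi>) = lift \<phi>"
  by (simp add: succ_inst_def lift_def)

lemma inst_subst_up: "inst t (subst (up \<sigma>) \<phi>) = subst (case_nat t \<sigma>) \<phi>"
proof -
  have "(\<lambda>i. subst_tm (case_nat t Var) (up \<sigma> i)) = case_nat t \<sigma>"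
  proof
    show "subst_tm (case_nat t Var) (up \<sigma> i) = case_nat t \<sigma> i" for i by (cases i) auto
  qed
  then show ?thesis by (simp add: inst_def)
qed

lemma inst_Var0_lift: "inst (Var 0) (subst (up (\<lambda>i. Var (Suc i))) \<phi>) = \<phi>"
proof -
  have "case_nat (Var 0) (\<lambda>i. Var (Suc i)) = Var"
    by (auto split: nat.split)
  then show ?thesis by (simp add: inst_subst_up)
qed

lemma lift_All: "lift (All \<phi>) = All (subst (up (\<lambda>i. Var (Suc i))) \<phi>)"
  and lift_Ex: "lift (Ex \<phi>) = Ex (subst (up (\<lambda>i. Var (Suc i))) \<phi>)"
  by (simp_all add: lift_def)

lemma lift_pow: "(lift ^^ n) \<phi> = subst (\<lambda>i. Var (i + n)) \<phi>"
  by (induction n) (simp_all add: lift_def)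

section \<open>Derived rules\<close>

lemma nd_wf: "nd T \<Gamma> \<phi> \<Longrightarrow> wf_fm \<phi>"
  by (induction rule: nd.induct) (auto simp: wf_inst)

lemma nd_weaken: "nd T \<Gamma> \<phi> \<Longrightarrow> \<Gamma> \<subseteq> \<Delta> \<Longrightarrow> nd T \<Delta> \<phi>"
proof (induction arbitrary: \<Delta> rule: nd.induct)
  case (OrE \<Gamma> \<phi> \<psi> \<chi>)
  show ?case
    by (rule nd.OrE[OF OrE.IH(1) OrE.IH(2) OrE.IH(3)]) (use OrE.prems in auto)
next
  case (ImpI \<phi> \<Gamma> \<psi>)
  show ?case
    by (rule nd.ImpI[OF ImpI.IH]) (use ImpI.prems ImpI.hyps(2) in auto)
next
  case (AllI \<Gamma> \<phi>)
  show ?case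
    by (rule nd.AllI[OF AllI.IH]) (use AllI.prems in auto)
next
  case (ExE \<Gamma> \<phi> \<chi>)
  show ?case
    by (rule nd.ExE[OF ExE.IH(1) ExE.IH(2)]) (use ExE.prems ExE.hyps(3) in auto)
next
  case (AndE1 \<Gamma> \<phi> \<psi>)
  show ?case by (rule nd.AndE1[OF AndE1.IH[OF AndE1.prems]])
next
  case (AndE2 \<Gamma> \<phi> \<psi>)
  show ?case by (rule nd.AndE2[OF AndE2.IH[OF AndE2.prems]])
next
  case (ImpE \<Gamma> \<phi> \<psi>)
  show ?case by (rule nd.ImpE[OF ImpE.IH(1)[OF ImpE.prems] ImpE.IH(2)[OF ImpE.prems]])
next
  case (FlsE \<Gamma> \<phi>)
  show ?case by (rule nd.FlsE[OF FlsE.IH[OF FlsE.prems] FlsE.hyps(2)])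
next
  case (AllE \<Gamma> \<phi> t)
  show ?case by (rule nd.AllE[OF AllE.IH[OF AllE.prems] AllE.hyps(2)])
next
  case (ExI \<Gamma> t \<phi>)
  show ?case by (rule nd.ExI[OF ExI.IH[OF ExI.prems] ExI.hyps(2,3)])
qed (auto intro: nd.Axiom nd.Hyp nd.AndI nd.OrI1 nd.OrI2)

lemma nd_mono: "nd T \<Gamma> \<phi> \<Longrightarrow> T \<subseteq> T' \<Longrightarrow> nd T' \<Gamma> \<phi>"
proof (induction rule: nd.induct)
  case (AndE1 \<Gamma> \<phi> \<psi>)
  then show ?case by (blast intro: nd.AndE1)
next
  case (AndE2 \<Gamma> \<phi> \<psi>)
  then show ?case by (blast intro: nd.AndE2)
next
  case (ImpE \<Gamma> \<phi> \<psi>)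
  then show ?case by (blast intro: nd.ImpE)
next
  case (OrE \<Gamma> \<phi> \<psi> \<chi>)
  then show ?case by (blast intro: nd.OrE)
next
  case (ExE \<Gamma> \<phi> \<chi>)
  then show ?case by (blast intro: nd.ExE)
next
  case (ExI \<Gamma> t \<phi>)
  then show ?case by (blast intro: nd.ExI)
next
  case (FlsE \<Gamma> \<phi>)
  show ?case by (rule nd.FlsE[OF FlsE.IH[OF FlsE.prems] FlsE.hyps(2)])
qed (auto intro: nd.Axiom nd.Hyp nd.AndI nd.OrI1 nd.OrI2 nd.ImpI nd.AllI nd.AllE)

lemma nd_weaken_empty: "nd T {} \<phi> \<Longrightarrow> nd T \<Gamma> \<phi>"
  by (rule nd_weaken) auto

text \<open>Once an eigenvariable has been introduced, a hypothesis \<open>All \<phi>\<close> is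
  present only in lifted form. Instantiating it at the fresh variable, index 0, gives back the body
  unchanged. \<open>nd_ExI0\<close> is the dual use of index 0 as a witness.\<close>

lemma nd_AllE0: "nd T \<Gamma> (lift (All \<phi>)) \<Longrightarrow> nd T \<Gamma> \<phi>"
  using AllE[of T \<Gamma> "subst (up (\<lambda>i. Var (Suc i))) \<phi>" "Var 0"]
  by (simp add: lift_All inst_Var0_lift)

lemma nd_ExI0: "nd T \<Gamma> \<phi> \<Longrightarrow> nd T \<Gamma> (lift (Ex \<phi>))"
  unfolding lift_Ex
  using nd_wf[of T \<Gamma> \<phi>] by (intro ExI[of _ _ "Var 0"]) (simp_all add: inst_Var0_lift wf_subst wf_up)

section \<open>Blocks of universal quantifiers and universal closures\<close>

lemma nd_AllI_pow: "nd T ((lift ^^ n) ` \<Gamma>) \<phi> \<Longrightarrow> nd T \<Gamma> ((All ^^ n) \<phi>)"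
proof (induction n arbitrary: \<Gamma>)
  case (Suc n)
  have "(lift ^^ Suc n) ` \<Gamma> = (lift ^^ n) ` lift ` \<Gamma>"
    by (simp add: image_comp funpow_Suc_right del: funpow.simps)
  then have "nd T (lift ` \<Gamma>) ((All ^^ n) \<phi>)"
    using Suc by simp
  then show ?case by (simp add: AllI)
qed simp

text \<open>The whole block is instantiated at once: the bound indices receive
  \<open>\<tau> 0\<close>, ..., \<open>\<tau> (n - 1)\<close>, the outermost quantifier taking
  \<open>\<tau> (n - 1)\<close>. Stripping that quantifier extends the substitution outside the
  block, so the induction runs with \<open>\<sigma>\<close> arbitrary.\<close>

lemma nd_AllE_pow:
  "nd T \<Gamma> (subst \<sigma> ((All ^^ n) \<phi>)) \<Longrightarrow> (\<And>i. wf_tm (\<tau> i)) \<Longrightarrow> (\<And>i. \<tau> (i + n) = \<sigma> i) \<Longrightarrow>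
    nd T \<Gamma> (subst \<tau> \<phi>)"
proof (induction n arbitrary: \<sigma>)
  case 0
  then have "\<tau> = \<sigma>" by auto
  then show ?case using 0 by simp
next
  case (Suc n)
  have "nd T \<Gamma> (inst (\<tau> n) (subst (up \<sigma>) ((All ^^ n) \<phi>)))"
    using Suc.prems(1,2) by (intro AllE) simp_all
  then have "nd T \<Gamma> (subst (case_nat (\<tau> n) \<sigma>) ((All ^^ n) \<phi>))"
    by (simp add: inst_subst_up)
  moreover have "\<tau> (i + n) = case_nat (\<tau> n) \<sigma> i" for i
    using Suc.prems(3) by (cases i) auto
  ultimately show ?case using Suc.IH Suc.prems(2) by blast
qed

lemma nd_AllE_closed:
  assumes "nd T \<Gamma> ((All ^^ n) \<phi>)" "fv \<phi> \<subseteq> {..<n}" "\<And>i. wf_tm (\<tau> i)"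
  shows "nd T \<Gamma> (subst \<tau> \<phi>)"
proof (rule nd_AllE_pow)
  have "fv ((All ^^ n) \<phi>) = {}" using assms(2) by (auto simp: fv_All_pow)
  then show "nd T \<Gamma> (subst (\<lambda>i. \<tau> (i + n)) ((All ^^ n) \<phi>))"
    using assms(1) by (simp add: subst_closed)
qed (use assms in auto)

text \<open>With no hypotheses, all free variables may be generalised. The closure is unaffected by
  substitution, and instantiating its prefix carries out \<open>\<tau>\<close>. The argument thus
  covers axiom sets that are not closed under substitution.\<close>

lemma nd_subst:
  assumes "T \<turnstile> \<phi>" "\<And>i. wf_tm (\<tau> i)"
  shows "T \<turnstile> subst \<tau> \<phi>"
proof -
  obtain n where n: "fv \<phi> \<subseteq> {..<n}"
    using fv_bounded by blast
  have "T \<turnstile> (All ^^ n) \<phi>" by (rule nd_AllI_pow) (simp add: assms)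
  then show ?thesis using n assms(2) nd_AllE_closed by blast
qed

lemma nd_LEM:
  assumes "LEM G \<subseteq> T" "\<phi> \<in> G" "wf_fm \<phi>"
  shows "nd T \<Gamma> (Or \<phi> (Neg \<phi>))"
proof -
  obtain n where n: "fv \<phi> \<subseteq> {..<n}"
    using fv_bounded by blast
  have "wf_fm ((All ^^ m) (Or \<phi> (Neg \<phi>)))" for m
    using assms(3) by (induction m) auto
  moreover have "(All ^^ n) (Or \<phi> (Neg \<phi>)) \<in> T"
    using assms(1,2) n by (auto simp: LEM_def)
  ultimately have "nd T \<Gamma> ((All ^^ n) (Or \<phi> (Neg \<phi>)))"
    by (intro Axiom)
  then have "nd T \<Gamma> (subst Var (Or \<phi> (Neg \<phi>)))"
    by (rule nd_AllE_closed) (use n in auto)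
  then show ?thesis by simp
qed

lemma nd_cut: "nd T \<Gamma> \<phi> \<Longrightarrow> nd T (insert \<phi> \<Gamma>) \<psi> \<Longrightarrow> nd T \<Gamma> \<psi>"
  by (rule ImpE[OF ImpI[OF _ nd_wf]])

lemma HypE: "Imp \<phi> \<psi> \<in> \<Gamma> \<Longrightarrow> nd T \<Gamma> \<phi> \<Longrightarrow> wf_fm \<psi> \<Longrightarrow> nd T \<Gamma> \<psi>"
  using nd_wf[of T \<Gamma> \<phi>] by (auto intro: ImpE[OF Hyp])

lemma nd_dnE: "Imp (Imp \<phi> R) R \<in> \<Gamma> \<Longrightarrow> nd T (insert \<phi> \<Gamma>) R \<Longrightarrow> wf_fm \<phi> \<Longrightarrow> nd T \<Gamma> R"
  using nd_wf[of T "insert \<phi> \<Gamma>" R] by (auto intro: HypE[OF _ ImpI])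

section \<open>The translation\<close>

abbreviation dn :: "fm \<Rightarrow> fm \<Rightarrow> fm" where
  "dn R \<phi> \<equiv> Imp (Imp \<phi> R) R"

text \<open>\<open>R\<close> may have free variables, so it is lifted under each quantifier to avoid
  capture. Only atoms, \<open>Or\<close> and \<open>Ex\<close> are doubly negated; the other
  connectives inherit stability under \<open>dn R\<close> from their parts.\<close>

primrec ntrans :: "fm \<Rightarrow> fm \<Rightarrow> fm" where
  "ntrans R (Eq s t) = dn R (Eq s t)"
| "ntrans R Fls = R"
| "ntrans R (And \<phi> \<psi>) = And (ntrans R \<phi>) (ntrans R \<psi>)"
| "ntrans R (Or \<phi> \<psi>) = dn R (Or (ntrans R \<phi>) (ntrans R \<psi>))"
| "ntrans R (Imp \<phi> \<psi>) = Imp (ntrans R \<phi>) (ntrans R \<psi>)"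
| "ntrans R (All \<phi>) = All (ntrans (lift R) \<phi>)"
| "ntrans R (Ex \<phi>) = dn R (Ex (ntrans (lift R) \<phi>))"

lemma wf_ntrans [simp]: "wf_fm R \<Longrightarrow> wf_fm \<phi> \<Longrightarrow> wf_fm (ntrans R \<phi>)"
  by (induction \<phi> arbitrary: R) auto

lemma subst_ntrans: "subst \<sigma> (ntrans R \<phi>) = ntrans (subst \<sigma> R) (subst \<sigma> \<phi>)"
  by (induction \<phi> arbitrary: \<sigma> R) (auto simp: subst_up_lift)

lemma lift_ntrans: "lift (ntrans R \<phi>) = ntrans (lift R) (lift \<phi>)"
  by (simp add: lift_def subst_ntrans)

text \<open>Substitution acts on \<open>R\<close> as well as on the formula, but
  \<open>lift R\<close> omits variable 0, so instantiating it returns \<open>R\<close>.\<close>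

lemma inst_ntrans: "inst t (ntrans (lift R) \<phi>) = ntrans R (inst t \<phi>)"
  using inst_lift[of t R] by (simp add: inst_def subst_ntrans del: inst_lift)

lemma succ_inst_ntrans: "succ_inst (ntrans (lift R) \<phi>) = ntrans (lift R) (succ_inst \<phi>)"
  using succ_inst_lift[of R] by (simp add: succ_inst_def subst_ntrans del: succ_inst_lift)

lemma ntrans_All_pow: "ntrans R ((All ^^ n) \<phi>) = (All ^^ n) (ntrans ((lift ^^ n) R) \<phi>)"
proof (induction n arbitrary: R)
  case (Suc n)
  then show ?case by (simp add: funpow_swap1[of lift])
qed simp

lemma nd_dnI: "nd T \<Gamma> \<phi> \<Longrightarrow> wf_fm R \<Longrightarrow> nd T \<Gamma> (dn R \<phi>)"
  using nd_wf[of T \<Gamma> \<phi>] by (auto intro!: ImpI HypE[of \<phi> R] intro: nd_weaken)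

text \<open>The reduction of triple to single negation, relative to \<open>R\<close>.\<close>

lemma nd_dn_dn_Imp:
  assumes "wf_fm X" "wf_fm R"
  shows "nd T \<Gamma> (Imp (dn R (Imp X R)) (Imp X R))"
proof (intro ImpI)
  show "nd T (insert X (insert (dn R (Imp X R)) \<Gamma>)) R"
  proof (rule HypE)
    show "nd T (insert X (insert (dn R (Imp X R)) \<Gamma>)) (Imp (Imp X R) R)"
      by (intro ImpI HypE[of X R] Hyp) (use assms in auto)
  qed (use assms in auto)
qed (use assms in auto)

text \<open>Atoms, disjunctions and existentials are translated to implications into
  \<open>R\<close>, where \<open>nd_dn_dn_Imp\<close> applies; \<open>Fls\<close> becomes
  \<open>R\<close>, and \<open>dn R R\<close> is applied to \<open>Imp R R\<close>. For the
  remaining connectives the double negation passes to the components, which are stable by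
  induction.\<close>

lemma ntrans_stable:
  "wf_fm R \<Longrightarrow> wf_fm \<phi> \<Longrightarrow> nd T \<Gamma> (Imp (dn R (ntrans R \<phi>)) (ntrans R \<phi>))"
proof (induction \<phi> arbitrary: R \<Gamma>)
  case Fls
  let ?G = "insert (dn R R) \<Gamma>"
  have "nd T ?G (Imp R R)" by (intro ImpI Hyp) (use Fls in auto)
  then have "nd T ?G R" by (rule HypE[rotated]) (use Fls in auto)
  then show ?case using Fls by (auto intro: ImpI)
next
  case (And \<phi> \<psi>)
  let ?A = "ntrans R \<phi>" and ?B = "ntrans R \<psi>"
  let ?G = "insert (dn R (And ?A ?B)) \<Gamma>"
  have wf: "wf_fm R" "wf_fm ?A" "wf_fm ?B" using And.prems by auto
  have "nd T (insert (And ?A ?B) (insert (Imp ?A R) ?G)) R"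
    by (intro HypE[of ?A R] AndE1[of _ _ ?A ?B] Hyp) (use wf in auto)
  then have "nd T (insert (Imp ?A R) ?G) R"
    by (rule nd_dnE[rotated]) (use wf in auto)
  then have A: "nd T ?G ?A"
    by (intro ImpE[OF And.IH(1)] ImpI) (use And.prems wf in auto)
  have "nd T (insert (And ?A ?B) (insert (Imp ?B R) ?G)) R"
    by (intro HypE[of ?B R] AndE2[of _ _ ?A ?B] Hyp) (use wf in auto)
  then have "nd T (insert (Imp ?B R) ?G) R"
    by (rule nd_dnE[rotated]) (use wf in auto)
  then have B: "nd T ?G ?B"
    by (intro ImpE[OF And.IH(2)] ImpI) (use And.prems wf in auto)
  show ?case using A B wf by (auto intro: ImpI AndI)
next
  case (Imp \<phi> \<psi>)
  let ?A = "ntrans R \<phi>" and ?B = "ntrans R \<psi>"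
  let ?G = "insert ?A (insert (dn R (Imp ?A ?B)) \<Gamma>)"
  have wf: "wf_fm R" "wf_fm ?A" "wf_fm ?B" using Imp.prems by auto
  have "nd T (insert (Imp ?A ?B) (insert (Imp ?B R) ?G)) R"
    by (intro HypE[of ?B R] HypE[of ?A ?B] Hyp) (use wf in auto)
  then have "nd T (insert (Imp ?B R) ?G) R"
    by (rule nd_dnE[rotated]) (use wf in auto)
  then have "nd T ?G ?B"
    by (intro ImpE[OF Imp.IH(2)] ImpI) (use Imp.prems wf in auto)
  then show ?case using wf by (auto intro: ImpI)
next
  case (All \<phi>)
  let ?A = "ntrans (lift R) \<phi>"
  let ?G = "insert (dn R (All ?A)) \<Gamma>"
  have wf: "wf_fm R" "wf_fm ?A" using All.prems by auto
  have "nd T (insert (lift (All ?A)) (insert (Imp ?A (lift R)) (lift ` ?G))) ?A"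
    by (rule nd_AllE0, rule Hyp) (use wf wf_lift[of "All ?A"] in auto)
  then have "nd T (insert (lift (All ?A)) (insert (Imp ?A (lift R)) (lift ` ?G))) (lift R)"
    by (rule HypE[rotated]) (use wf in auto)
  then have "nd T (insert (Imp ?A (lift R)) (lift ` ?G)) (lift R)"
    by (rule nd_dnE[rotated]) (use wf wf_lift[of "All ?A"] in auto)
  then have "nd T (lift ` ?G) ?A"
    by (intro ImpE[OF All.IH] ImpI) (use All.prems wf in auto)
  then have "nd T ?G (All ?A)" by (rule AllI)
  then show ?case using wf by (auto intro: ImpI)
qed (auto intro!: nd_dn_dn_Imp)

text \<open>Since translated formulas are stable, a premise under \<open>dn R\<close> can be used as
  if it were bare whenever the goal is a translation. This simulates \<open>OrE\<close> and
  \<open>ExE\<close>, whose main premises are translated with a double negation in front.\<close>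

lemma ntrans_bind:
  assumes "nd T \<Gamma> (dn R \<phi>)" "nd T (insert \<phi> \<Gamma>) (ntrans R \<chi>)" "wf_fm \<chi>"
  shows "nd T \<Gamma> (ntrans R \<chi>)"
proof -
  let ?G = "insert (Imp (ntrans R \<chi>) R) \<Gamma>"
  have wf: "wf_fm R" "wf_fm \<phi>" using nd_wf[OF assms(1)] by auto
  have "nd T (insert \<phi> ?G) R"
    by (intro HypE[of "ntrans R \<chi>" R] nd_weaken[OF assms(2)]) (use wf in auto)
  then have "nd T ?G (Imp \<phi> R)" using wf by (auto intro: ImpI)
  moreover have "nd T ?G (dn R \<phi>)" by (rule nd_weaken[OF assms(1)]) auto
  ultimately have "nd T ?G R" by (rule ImpE[rotated])
  then show ?thesis
    by (intro ImpE[OF ntrans_stable] ImpI) (use wf assms in auto)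
qed

text \<open>\<open>R\<close> plays the role of falsum among translated formulas: it implies any
  double negation relative to \<open>R\<close>, and stability removes that double negation.\<close>

lemma ntrans_efq: "nd T \<Gamma> R \<Longrightarrow> wf_fm \<phi> \<Longrightarrow> nd T \<Gamma> (ntrans R \<phi>)"
  using nd_wf[of T \<Gamma> R]
  by (intro ImpE[OF ntrans_stable] ImpI) (auto intro: nd_weaken)

section \<open>Translation of the axioms, and soundness\<close>

lemma nd_dn_map:
  assumes "T \<turnstile> Imp \<phi> \<psi>" "wf_fm R"
  shows "nd T \<Gamma> (Imp (dn R \<phi>) (dn R \<psi>))"
proof (intro ImpI)
  let ?G = "insert (Imp \<psi> R) (insert (dn R \<phi>) \<Gamma>)"
  have wf: "wf_fm \<phi>" "wf_fm \<psi>" using nd_wf[OF assms(1)] by auto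
  have "nd T (insert \<phi> ?G) (Imp \<phi> \<psi>)"
    by (rule nd_weaken[OF assms(1)]) auto
  moreover have "nd T (insert \<phi> ?G) \<phi>" using wf by (auto intro: Hyp)
  ultimately have "nd T (insert \<phi> ?G) \<psi>" by (rule ImpE)
  then have "nd T (insert \<phi> ?G) R"
    by (rule HypE[rotated]) (use wf assms in auto)
  then show "nd T ?G R"
    by (rule nd_dnE[rotated]) (use wf assms in auto)
qed (use nd_wf[OF assms(1)] assms(2) in auto)

text \<open>Equations follow by \<open>nd_dnI\<close>, and implications from one equation to another
  by \<open>nd_dn_map\<close>. For \<open>eucl\<close> both double negations are opened in turn; in
  \<open>succ_not_zero\<close> the conclusion \<open>Fls\<close> becomes \<open>R\<close>, reached
  by ex falso.\<close>

lemma ntrans_HA: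
  assumes "\<phi> \<in> HA" "wf_fm \<phi>" "wf_fm R"
  shows "nd HA \<Gamma> (ntrans R \<phi>)"
proof -
  have ax: "nd HA \<Delta> \<phi>" for \<Delta> using assms by (auto intro: Axiom)
  show ?thesis
    using assms(1)
  proof cases
    case (eucl r s t)
    let ?P = "Eq r s" and ?Q = "Eq r t"
    let ?G = "insert (And (dn R ?P) (dn R ?Q)) \<Gamma>"
    have wf: "wf_fm ?P" "wf_fm ?Q" using eucl by auto
    have P: "nd HA ?G (dn R ?P)" by (rule AndE1[OF Hyp[of "And (dn R ?P) (dn R ?Q)"]]) (use wf assms in auto)
    have Q: "nd HA (insert ?P ?G) (dn R ?Q)" by (rule AndE2[OF Hyp[of "And (dn R ?P) (dn R ?Q)"]]) (use wf assms in auto)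
    have "nd HA (insert ?Q (insert ?P ?G)) (And ?P ?Q)"
      by (intro AndI Hyp) (use wf in auto)
    then have "nd HA (insert ?Q (insert ?P ?G)) (Eq s t)"
      by (rule ImpE[OF ax[unfolded eucl(1)]])
    then have "nd HA (insert ?Q (insert ?P ?G)) (ntrans R (Eq s t))"
      using assms(3) by (auto intro: nd_dnI)
    then have "nd HA ?G (ntrans R (Eq s t))"
      using eucl by (intro ntrans_bind[OF P] ntrans_bind[OF Q]) auto
    then show ?thesis using eucl wf assms(3) by (auto intro: ImpI)
  next
    case (succ_not_zero t)
    let ?P = "Eq (succ t) zero"
    let ?G = "insert (dn R ?P) \<Gamma>"
    have wf: "wf_fm ?P" using succ_not_zero by auto
    have "nd HA (insert ?P ?G) Fls"
      by (rule ImpE[OF ax[unfolded succ_not_zero(1)] Hyp]) (use wf in auto)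
    then have "nd HA (insert ?P ?G) R" by (rule FlsE) (rule assms)
    then have "nd HA ?G R"
      by (rule nd_dnE[rotated]) (use wf assms in auto)
    then show ?thesis using wf assms(3) succ_not_zero(1) by (auto intro: ImpI)
  next
    case (ind \<psi>)
    let ?A = "ntrans (lift R) \<psi>"
    have "wf_fm (ntrans R \<phi>)" using assms by simp
    \<comment> \<open>An induction axiom translates to the induction axiom of the translated
      formula.\<close>
    moreover have "ntrans R \<phi> = Imp (And (inst zero ?A) (All (Imp ?A (succ_inst ?A)))) (All ?A)"
      by (simp add: ind inst_ntrans succ_inst_ntrans)
    moreover have "Imp (And (inst zero ?A) (All (Imp ?A (succ_inst ?A)))) (All ?A) \<in> HA"
      using ind assms by (auto intro: HA.ind)
    ultimately show ?thesis by (metis Axiom)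
  qed (use ax assms in \<open>auto intro: nd_dnI nd_dn_map\<close>)
qed

text \<open>Refuting the disjunction, relative to \<open>R\<close>, refutes \<open>A\<close> through
  the left disjunct; that refutation is the right disjunct.\<close>

lemma nd_dn_LEM:
  assumes "wf_fm A" "wf_fm R"
  shows "nd T \<Gamma> (dn R (Or A (Imp A R)))"
proof (rule ImpI)
  let ?G = "insert (Imp (Or A (Imp A R)) R) \<Gamma>"
  have "nd T (insert A ?G) R"
    by (intro HypE[of "Or A (Imp A R)" R] OrI1 Hyp) (use assms in auto)
  then have "nd T ?G (Or A (Imp A R))"
    by (intro OrI2 ImpI) (use assms in auto)
  then show "nd T ?G R" by (rule HypE[rotated]) (use assms in auto)
qed (use assms in auto)

lemma wf_All_pow [simp]: "wf_fm ((All ^^ n) \<phi>) = wf_fm \<phi>"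
  and wf_Ex_pow [simp]: "wf_fm ((Ex ^^ n) \<phi>) = wf_fm \<phi>"
  and wf_lift_pow [simp]: "wf_fm R \<Longrightarrow> wf_fm ((lift ^^ n) R)"
  by (induction n) auto

lemma ntrans_PA_axiom:
  assumes "\<phi> \<in> PA" "wf_fm \<phi>" "wf_fm R"
  shows "nd HA \<Gamma> (ntrans R \<phi>)"
proof (cases "\<phi> \<in> HA")
  case True
  then show ?thesis using assms ntrans_HA by blast
next
  case False
  then obtain n \<psi> where \<phi>: "\<phi> = (All ^^ n) (Or \<psi> (Neg \<psi>))" "wf_fm \<psi>"
    using assms(1) by (auto simp: PA_def LEM_def)
  then show ?thesis
    using assms(3) by (auto simp: ntrans_All_pow intro!: nd_AllI_pow nd_dn_LEM)
qed

text \<open>\<open>R\<close> stays arbitrary in the induction because crossing a quantifier replaces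
  it by \<open>lift R\<close>. Introductions of \<open>Or\<close> and \<open>Ex\<close> go through
  \<open>nd_dnI\<close>, their eliminations through \<open>ntrans_bind\<close>, and ex falso through
  \<open>ntrans_efq\<close>.\<close>

theorem ntrans_sound: "nd PA \<Gamma> \<phi> \<Longrightarrow> wf_fm R \<Longrightarrow> nd HA (ntrans R ` \<Gamma>) (ntrans R \<phi>)"
proof (induction arbitrary: R rule: nd.induct)
  case (Axiom \<phi> \<Gamma>)
  then show ?case using ntrans_PA_axiom by blast
next
  case (Hyp \<phi> \<Gamma>)
  then show ?case by (auto intro: nd.Hyp)
next
  case (FlsE \<Gamma> \<phi>)
  have "nd HA (ntrans R ` \<Gamma>) R" using FlsE.IH[OF FlsE.prems] by simp
  then show ?case using FlsE.hyps(2) by (rule ntrans_efq)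
next
  case (AndI \<Gamma> \<phi> \<psi>)
  then show ?case by (auto intro: nd.AndI)
next
  case (AndE1 \<Gamma> \<phi> \<psi>)
  show ?case using AndE1.IH[OF AndE1.prems] by (auto dest: nd.AndE1)
next
  case (AndE2 \<Gamma> \<phi> \<psi>)
  show ?case using AndE2.IH[OF AndE2.prems] by (auto dest: nd.AndE2)
next
  case (OrI1 \<Gamma> \<phi> \<psi>)
  then show ?case by (auto intro!: nd_dnI nd.OrI1)
next
  case (OrI2 \<Gamma> \<psi> \<phi>)
  then show ?case by (auto intro!: nd_dnI nd.OrI2)
next
  case (OrE \<Gamma> \<phi> \<psi> \<chi>)
  let ?A = "ntrans R \<phi>" and ?B = "ntrans R \<psi>" and ?G = "ntrans R ` \<Gamma>"
  have wf: "wf_fm ?A" "wf_fm ?B" "wf_fm \<chi>"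
    using nd_wf[OF OrE.hyps(1)] nd_wf[OF OrE.hyps(2)] OrE.prems by auto
  have "nd HA (insert (Or ?A ?B) ?G) (ntrans R \<chi>)"
  proof (rule nd.OrE)
    show "nd HA (insert (Or ?A ?B) ?G) (Or ?A ?B)" using wf by (auto intro: nd.Hyp)
    show "nd HA (insert ?A (insert (Or ?A ?B) ?G)) (ntrans R \<chi>)"
      by (rule nd_weaken[OF OrE.IH(2)[OF OrE.prems]]) auto
    show "nd HA (insert ?B (insert (Or ?A ?B) ?G)) (ntrans R \<chi>)"
      by (rule nd_weaken[OF OrE.IH(3)[OF OrE.prems]]) auto
  qed
  then show ?case
    using OrE.IH(1)[OF OrE.prems] wf(3) by (intro ntrans_bind[of HA ?G "Or ?A ?B" R]) auto
next
  case (ImpI \<phi> \<Gamma> \<psi>)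
  then show ?case by (auto intro: nd.ImpI)
next
  case (ImpE \<Gamma> \<phi> \<psi>)
  show ?case
    using ImpE.IH(1)[OF ImpE.prems] ImpE.IH(2)[OF ImpE.prems] by (auto dest: nd.ImpE)
next
  case (AllI \<Gamma> \<phi>)
  have "nd HA (ntrans (lift R) ` lift ` \<Gamma>) (ntrans (lift R) \<phi>)"
    using AllI.prems by (intro AllI.IH) simp
  then have "nd HA (lift ` ntrans R ` \<Gamma>) (ntrans (lift R) \<phi>)"
    by (simp add: image_image lift_ntrans)
  then show ?case by (auto intro: nd.AllI)
next
  case (AllE \<Gamma> \<phi> t)
  have "nd HA (ntrans R ` \<Gamma>) (All (ntrans (lift R) \<phi>))"
    using AllE.IH[OF AllE.prems] by simp
  then show ?case using nd.AllE AllE.hyps(2) inst_ntrans by metis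
next
  case (ExI \<Gamma> t \<phi>)
  have "nd HA (ntrans R ` \<Gamma>) (inst t (ntrans (lift R) \<phi>))"
    using ExI.IH[OF ExI.prems] by (simp add: inst_ntrans)
  then have "nd HA (ntrans R ` \<Gamma>) (Ex (ntrans (lift R) \<phi>))"
    using ExI.hyps ExI.prems by (intro nd.ExI) auto
  then show ?case using ExI.prems by (auto intro: nd_dnI)
next
  case (ExE \<Gamma> \<phi> \<chi>)
  let ?A = "ntrans (lift R) \<phi>" and ?G = "ntrans R ` \<Gamma>"
  have wf: "wf_fm ?A" "wf_fm (ntrans R \<chi>)"
    using nd_wf[OF ExE.hyps(1)] ExE.hyps(3) ExE.prems by auto
  have "nd HA (ntrans (lift R) ` insert \<phi> (lift ` \<Gamma>)) (ntrans (lift R) (lift \<chi>))"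
    using ExE.prems by (intro ExE.IH(2)) simp
  then have *: "nd HA (insert ?A (lift ` ?G)) (lift (ntrans R \<chi>))"
    by (simp add: image_image lift_ntrans)
  have "nd HA (insert (Ex ?A) ?G) (ntrans R \<chi>)"
  proof (rule nd.ExE)
    show "nd HA (insert (Ex ?A) ?G) (Ex ?A)" using wf by (auto intro: nd.Hyp)
    show "nd HA (insert ?A (lift ` insert (Ex ?A) ?G)) (lift (ntrans R \<chi>))"
      by (rule nd_weaken[OF *]) auto
  qed (rule wf)
  then show ?case
    using ExE.IH(1)[OF ExE.prems] ExE.hyps(3) by (intro ntrans_bind[of HA ?G "Ex ?A" R]) auto
qed

section \<open>Prenex classes\<close>

lemma subst_All_pow: "subst \<sigma> ((All ^^ n) \<phi>) = (All ^^ n) (subst ((up ^^ n) \<sigma>) \<phi>)"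
  and subst_Ex_pow: "subst \<sigma> ((Ex ^^ n) \<phi>) = (Ex ^^ n) (subst ((up ^^ n) \<sigma>) \<phi>)"
  by (induction n arbitrary: \<sigma>) (simp_all add: funpow_swap1[of up])

lemma wf_up_pow: "(\<And>i. wf_tm (\<sigma> i)) \<Longrightarrow> wf_tm ((up ^^ n) \<sigma> i)"
  by (induction n arbitrary: i) (auto intro: wf_up)

lemma qfree_subst: "qfree (subst \<sigma> \<phi>) = qfree \<phi>"
  by (induction \<phi> arbitrary: \<sigma>) auto

lemma subst_cls:
  assumes "\<And>i. wf_tm (\<sigma> i)"
  shows "\<phi> \<in> \<Sigma>_cls j \<Longrightarrow> subst \<sigma> \<phi> \<in> \<Sigma>_cls j" "\<phi> \<in> \<Pi>_cls j \<Longrightarrow> subst \<sigma> \<phi> \<in> \<Pi>_cls j"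
  using assms
proof (induction j arbitrary: \<phi> \<sigma>)
  case (Suc j)
  { case 1
    then obtain n \<psi> where "\<phi> = (Ex ^^ n) \<psi>" "\<psi> \<in> \<Pi>_cls j" by auto
    then show ?case using Suc.IH(2)[of \<psi> "(up ^^ n) \<sigma>"] wf_up_pow[OF 1(2)]
      by (auto simp: subst_Ex_pow)
  next
    case 2
    then obtain n \<psi> where "\<phi> = (All ^^ n) \<psi>" "\<psi> \<in> \<Sigma>_cls j" by auto
    then show ?case using Suc.IH(1)[of \<psi> "(up ^^ n) \<sigma>"] wf_up_pow[OF 2(2)]
      by (auto simp: subst_All_pow) }
qed (auto simp: qfree_subst wf_subst)

lemma prenex_subst: "prenex \<phi> \<Longrightarrow> (\<And>i. wf_tm (\<sigma> i)) \<Longrightarrow> prenex (subst \<sigma> \<phi>)"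
  unfolding prenex_def using subst_cls by blast

lemma cls_subset_Suc: "\<Sigma>_cls j \<subseteq> \<Sigma>_cls (Suc j) \<and> \<Pi>_cls j \<subseteq> \<Pi>_cls (Suc j)"
proof (induction j)
  case 0
  have "(Ex ^^ 0) \<phi> \<in> \<Sigma>_cls (Suc 0)" "(All ^^ 0) \<phi> \<in> \<Pi>_cls (Suc 0)"
    if "wf_fm \<phi>" "qfree \<phi>" for \<phi>
    unfolding \<Sigma>_cls.simps \<Pi>_cls.simps using that by blast+
  then show ?case by (simp add: subset_iff del: \<Sigma>_cls.simps(2) \<Pi>_cls.simps(2))
next
  case (Suc j)
  have "\<Sigma>_cls (Suc j) \<subseteq> \<Sigma>_cls (Suc (Suc j))"
    unfolding \<Sigma>_cls.simps(2) using Suc by blast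
  moreover have "\<Pi>_cls (Suc j) \<subseteq> \<Pi>_cls (Suc (Suc j))"
    unfolding \<Pi>_cls.simps(2) using Suc by blast
  ultimately show ?case ..
qed

lemma \<Sigma>_cls_mono: "i \<le> j \<Longrightarrow> \<Sigma>_cls i \<subseteq> \<Sigma>_cls j"
  by (rule lift_Suc_mono_le) (simp_all add: cls_subset_Suc del: \<Sigma>_cls.simps)

text \<open>The alternation is forgotten and blocks are unfolded one quantifier at a time, which
  suits properties that do not depend on the level.\<close>

lemma cls_induct [consumes 1, case_names qfree All Ex]:
  assumes "\<phi> \<in> \<Sigma>_cls j \<union> \<Pi>_cls j"
    and qf: "\<And>\<phi>. wf_fm \<phi> \<Longrightarrow> qfree \<phi> \<Longrightarrow> P \<phi>"
    and All: "\<And>\<phi>. wf_fm \<phi> \<Longrightarrow> P \<phi> \<Longrightarrow> P (All \<phi>)"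
    and Ex: "\<And>\<phi>. wf_fm \<phi> \<Longrightarrow> P \<phi> \<Longrightarrow> P (Ex \<phi>)"
  shows "P \<phi>"
proof -
  have "wf_fm \<phi> \<and> P \<phi>" if "\<phi> \<in> \<Sigma>_cls j \<union> \<Pi>_cls j" for \<phi>
    using that
  proof (induction j arbitrary: \<phi>)
    case 0
    then show ?case using qf by auto
  next
    case (Suc j)
    from Suc.prems obtain n \<psi>
      where "\<phi> = (Ex ^^ n) \<psi> \<or> \<phi> = (All ^^ n) \<psi>" and "\<psi> \<in> \<Sigma>_cls j \<union> \<Pi>_cls j"
      by auto
    moreover from this(2) have "wf_fm \<psi> \<and> P \<psi>" by (rule Suc.IH)
    then have "wf_fm ((Ex ^^ n) \<psi>) \<and> P ((Ex ^^ n) \<psi>)" "wf_fm ((All ^^ n) \<psi>) \<and> P ((All ^^ n) \<psi>)"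
      by (induction n) (auto intro: All Ex)
    ultimately show ?case by auto
  qed
  then show ?thesis using assms(1) by blast
qed

lemma cls_wf: "\<phi> \<in> \<Sigma>_cls j \<union> \<Pi>_cls j \<Longrightarrow> wf_fm \<phi>"
  by (induction rule: cls_induct) auto

text \<open>The classical negation of a prenex formula, pushed through the quantifier prefix down to
  the matrix. It exchanges the two classes of a level (\<open>dual_cls\<close>), whereas
  \<open>Neg\<close> of a quantified formula is no longer prenex.\<close>

primrec dual :: "fm \<Rightarrow> fm" where
  "dual (Eq s t) = Neg (Eq s t)"
| "dual Fls = Neg Fls"
| "dual (And \<phi> \<psi>) = Neg (And \<phi> \<psi>)"
| "dual (Or \<phi> \<psi>) = Neg (Or \<phi> \<psi>)"
| "dual (Imp \<phi> \<psi>) = Neg (Imp \<phi> \<psi>)"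
| "dual (All \<phi>) = Ex (dual \<phi>)"
| "dual (Ex \<phi>) = All (dual \<phi>)"

lemma dual_qfree: "qfree \<phi> \<Longrightarrow> dual \<phi> = Neg \<phi>"
  by (cases \<phi>) auto

lemma wf_dual [simp]: "wf_fm (dual \<phi>) = wf_fm \<phi>"
  by (induction \<phi>) auto

lemma dual_All_pow: "dual ((All ^^ n) \<phi>) = (Ex ^^ n) (dual \<phi>)"
  and dual_Ex_pow: "dual ((Ex ^^ n) \<phi>) = (All ^^ n) (dual \<phi>)"
  by (induction n) auto

lemma dual_cls:
  "\<phi> \<in> \<Sigma>_cls j \<Longrightarrow> dual \<phi> \<in> \<Pi>_cls j" "\<phi> \<in> \<Pi>_cls j \<Longrightarrow> dual \<phi> \<in> \<Sigma>_cls j"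
proof (induction j arbitrary: \<phi>)
  case (Suc j)
  { case 1
    then show ?case using Suc.IH(2) by (auto simp: dual_Ex_pow) blast
  next
    case 2
    then show ?case using Suc.IH(1) by (auto simp: dual_All_pow) blast }
qed (auto simp: dual_qfree)

section \<open>Consequences of the law of excluded middle\<close>

lemma nd_contr: "wf_fm \<phi> \<Longrightarrow> nd T \<Gamma> (Imp \<phi> (Neg (Neg \<phi>)))"
  by (intro ImpI HypE[of \<phi> Fls] Hyp) auto

text \<open>At each quantifier one of the two formulas is existential; its eigenvariable
  instantiates the universal one, so the clash descends to the bodies.\<close>

lemma nd_dual_contr: "wf_fm \<phi> \<Longrightarrow> nd T \<Gamma> (Imp \<phi> (Imp (dual \<phi>) Fls))"
proof (induction \<phi> arbitrary: \<Gamma>)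
  case (All \<phi>)
  let ?G = "insert (dual (All \<phi>)) (insert (All \<phi>) \<Gamma>)"
  let ?H = "insert (dual \<phi>) (lift ` ?G)"
  have 1: "nd T ?H \<phi>"
    by (rule nd_AllE0, rule Hyp) (use All.prems wf_lift[of "All \<phi>"] in auto)
  have 2: "nd T ?H (dual \<phi>)" using All.prems by (auto intro: Hyp)
  have "nd T ?H (Imp \<phi> (Imp (dual \<phi>) Fls))" using All.prems by (intro All.IH) simp
  then have 3: "nd T ?H (lift Fls)"
    unfolding lift_simps by (rule ImpE[OF ImpE]) (rule 1 2)+
  have "nd T ?G (Ex (dual \<phi>))" using All.prems by (auto intro: Hyp)
  then have "nd T ?G Fls" using 3 by (rule ExE) simp
  then show ?case using All.prems by (auto intro!: ImpI)
next
  case (Ex \<phi>)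
  let ?G = "insert (dual (Ex \<phi>)) (insert (Ex \<phi>) \<Gamma>)"
  let ?H = "insert \<phi> (lift ` ?G)"
  have 1: "nd T ?H (dual \<phi>)"
    by (rule nd_AllE0, rule Hyp) (use Ex.prems wf_lift[of "All (dual \<phi>)"] in auto)
  have 2: "nd T ?H \<phi>" using Ex.prems by (auto intro: Hyp)
  have "nd T ?H (Imp \<phi> (Imp (dual \<phi>) Fls))" using Ex.prems by (intro Ex.IH) simp
  then have 3: "nd T ?H (lift Fls)"
    unfolding lift_simps by (rule ImpE[OF ImpE]) (rule 2 1)+
  have "nd T ?G (Ex \<phi>)" using Ex.prems by (auto intro: Hyp)
  then have "nd T ?G Fls" using 3 by (rule ExE) simp
  then show ?case using Ex.prems by (auto intro!: ImpI)
qed (auto intro!: nd_contr)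

lemma nd_dualE:
  assumes "nd T \<Gamma> \<phi>" "nd T \<Gamma> (dual \<phi>)" "wf_fm \<chi>"
  shows "nd T \<Gamma> \<chi>"
proof -
  have "nd T \<Gamma> (Imp \<phi> (Imp (dual \<phi>) Fls))"
    using nd_wf[OF assms(1)] by (rule nd_dual_contr)
  then have "nd T \<Gamma> Fls" by (rule ImpE[OF ImpE]) (rule assms)+
  then show ?thesis using assms(3) by (rule FlsE)
qed

text \<open>Decide the existential. If it fails, the fresh variable cannot satisfy the body, so the
  decision for the body leaves its dual at that variable, which is then generalised.\<close>

lemma dual_LEM_Ex:
  assumes "\<And>\<Gamma>. nd T \<Gamma> (Or (Ex \<phi>) (Neg (Ex \<phi>)))" "\<And>\<Gamma>. nd T \<Gamma> (Or \<phi> (dual \<phi>))"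
  shows "nd T \<Gamma> (Or (Ex \<phi>) (dual (Ex \<phi>)))"
proof (rule OrE[OF assms(1)])
  have wf: "wf_fm \<phi>" using nd_wf[OF assms(2)] by auto
  then show "nd T (insert (Ex \<phi>) \<Gamma>) (Or (Ex \<phi>) (dual (Ex \<phi>)))"
    by (auto intro!: OrI1 intro: Hyp)
  let ?G = "insert (Neg (Ex \<phi>)) \<Gamma>"
  have "nd T (lift ` ?G) (dual \<phi>)"
  proof (rule OrE[OF assms(2)])
    have "nd T (insert \<phi> (lift ` ?G)) (lift (Ex \<phi>))"
      using wf by (intro nd_ExI0 Hyp) auto
    then have "nd T (insert \<phi> (lift ` ?G)) Fls"
      by (rule HypE[rotated]) auto
    then show "nd T (insert \<phi> (lift ` ?G)) (dual \<phi>)" by (rule FlsE) (use wf in simp)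
    show "nd T (insert (dual \<phi>) (lift ` ?G)) (dual \<phi>)" using wf by (auto intro: Hyp)
  qed
  then show "nd T ?G (Or (Ex \<phi>) (dual (Ex \<phi>)))"
    using wf by (auto intro!: OrI2 AllI)
qed

text \<open>Excluded middle is applied to the existence of a counterexample rather than to the
  universal formula. If there is none, the decision for the body leaves \<open>\<phi>\<close> at the
  fresh variable.\<close>

lemma dual_LEM_All:
  assumes "\<And>\<Gamma>. nd T \<Gamma> (Or (Ex (dual \<phi>)) (Neg (Ex (dual \<phi>))))" "\<And>\<Gamma>. nd T \<Gamma> (Or \<phi> (dual \<phi>))"
  shows "nd T \<Gamma> (Or (All \<phi>) (dual (All \<phi>)))"
proof (rule OrE[OF assms(1)])
  have wf: "wf_fm \<phi>" using nd_wf[OF assms(2)] by auto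
  then show "nd T (insert (Ex (dual \<phi>)) \<Gamma>) (Or (All \<phi>) (dual (All \<phi>)))"
    by (auto intro!: OrI2 intro: Hyp)
  let ?G = "insert (Neg (Ex (dual \<phi>))) \<Gamma>"
  have "nd T (lift ` ?G) \<phi>"
  proof (rule OrE[OF assms(2)])
    have "nd T (insert (dual \<phi>) (lift ` ?G)) (lift (Ex (dual \<phi>)))"
      using wf by (intro nd_ExI0 Hyp) auto
    then have "nd T (insert (dual \<phi>) (lift ` ?G)) Fls"
      by (rule HypE[rotated]) auto
    then show "nd T (insert (dual \<phi>) (lift ` ?G)) \<phi>" by (rule FlsE) (use wf in simp)
    show "nd T (insert \<phi> (lift ` ?G)) \<phi>" using wf by (auto intro: Hyp)
  qed
  then show "nd T ?G (Or (All \<phi>) (dual (All \<phi>)))"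
    using wf by (auto intro!: OrI1 AllI)
qed

text \<open>An outer induction on the level and an inner one on the length of the leading block
  decide one quantifier at a time.\<close>

lemma dual_LEM:
  assumes "LEM (\<Sigma>_cls k) \<subseteq> T"
  shows "j \<le> k \<Longrightarrow> \<phi> \<in> \<Sigma>_cls j \<union> \<Pi>_cls j \<Longrightarrow> nd T \<Gamma> (Or \<phi> (dual \<phi>))"
proof (induction j arbitrary: \<phi> \<Gamma>)
  case 0
  then have "\<phi> \<in> \<Sigma>_cls k" using \<Sigma>_cls_mono[of 0 k] by auto
  then show ?case using 0 nd_LEM[OF assms] by (auto simp: dual_qfree)
next
  case (Suc j)
  have lem: "nd T \<Delta> (Or \<psi> (Neg \<psi>))" if "\<psi> \<in> \<Sigma>_cls (Suc j)" for \<psi> \<Delta>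
    using that \<Sigma>_cls_mono[OF Suc.prems(1)] nd_LEM[OF assms] cls_wf by blast
  from Suc.prems(2) consider
    (Ex) n \<psi> where "\<phi> = (Ex ^^ n) \<psi>" "\<psi> \<in> \<Pi>_cls j"
  | (All) n \<psi> where "\<phi> = (All ^^ n) \<psi>" "\<psi> \<in> \<Sigma>_cls j"
    by auto
  then show ?case
  proof cases
    case Ex
    have "nd T \<Delta> (Or ((Ex ^^ n) \<psi>) (dual ((Ex ^^ n) \<psi>)))" for \<Delta>
    proof (induction n arbitrary: \<Delta>)
      case 0
      then show ?case using Suc.IH[of \<psi> \<Delta>] Suc.prems(1) Ex(2) by auto
    next
      case (Suc n)
      \<comment> \<open>Block lengths are arbitrary, so each partial block is still in the class and
        excluded middle holds for it.\<close>
      have "(Ex ^^ Suc n) \<psi> \<in> \<Sigma>_cls (Suc j)" using Ex(2) unfolding \<Sigma>_cls.simps by blast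
      then have "nd T \<Delta> (Or (fm.Ex ((Ex ^^ n) \<psi>)) (Neg (fm.Ex ((Ex ^^ n) \<psi>))))" for \<Delta>
        using lem by simp
      then show ?case using dual_LEM_Ex[OF _ Suc.IH] by simp
    qed
    then show ?thesis using Ex by blast
  next
    case All
    have "nd T \<Delta> (Or ((All ^^ n) \<psi>) (dual ((All ^^ n) \<psi>)))" for \<Delta>
    proof (induction n arbitrary: \<Delta>)
      case 0
      then show ?case using Suc.IH[of \<psi> \<Delta>] Suc.prems(1) All(2) by auto
    next
      case (Suc n)
      \<comment> \<open>The formula asserting a counterexample is again a \<Sigma> formula, which is
        how excluded middle for \<Sigma> formulas also decides \<Pi> formulas.\<close>
      have "(Ex ^^ Suc n) (dual \<psi>) \<in> \<Sigma>_cls (Suc j)"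
        using dual_cls(1)[OF All(2)] unfolding \<Sigma>_cls.simps by blast
      then have "nd T \<Delta> (Or (Ex (dual ((All ^^ n) \<psi>))) (Neg (Ex (dual ((All ^^ n) \<psi>)))))" for \<Delta>
        using lem by (simp add: dual_All_pow)
      then show ?case using dual_LEM_All[OF _ Suc.IH] by simp
    qed
    then show ?thesis using All by blast
  qed
qed

section \<open>Comparing a formula with its translation\<close>

text \<open>A rule over all \<open>R\<close> and \<open>\<Gamma>\<close>, since both are lifted when
  an eigenvariable is introduced.\<close>

definition implies_ntrans :: "fm set \<Rightarrow> fm \<Rightarrow> bool" where
  "implies_ntrans T \<phi> \<longleftrightarrow> (\<forall>R \<Gamma>. wf_fm R \<longrightarrow> nd T \<Gamma> \<phi> \<longrightarrow> nd T \<Gamma> (ntrans R \<phi>))"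

text \<open>Rule form of \<open>Imp (ntrans R \<phi>) (dn R \<phi>)\<close>, a weak converse of
  \<open>implies_ntrans\<close>: the formula is recovered up to a double negation relative to
  \<open>R\<close>.\<close>

definition ntrans_implies_dn :: "fm set \<Rightarrow> fm \<Rightarrow> bool" where
  "ntrans_implies_dn T \<phi> \<longleftrightarrow>
    (\<forall>R \<Gamma>. nd T \<Gamma> (ntrans R \<phi>) \<longrightarrow> nd T (insert \<phi> \<Gamma>) R \<longrightarrow> nd T \<Gamma> R)"

lemma implies_ntransD:
  "implies_ntrans T \<phi> \<Longrightarrow> wf_fm R \<Longrightarrow> nd T \<Gamma> \<phi> \<Longrightarrow> nd T \<Gamma> (ntrans R \<phi>)"
  by (auto simp: implies_ntrans_def)

lemma ntrans_implies_dnD: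
  "ntrans_implies_dn T \<phi> \<Longrightarrow> nd T \<Gamma> (ntrans R \<phi>) \<Longrightarrow> nd T (insert \<phi> \<Gamma>) R \<Longrightarrow> nd T \<Gamma> R"
  by (auto simp: ntrans_implies_dn_def)

text \<open>The two directions are proved together because implication is contravariant: each
  direction for \<open>Imp\<close> uses the opposite one for the antecedent.\<close>

lemma qfree_ntrans:
  assumes "\<And>\<psi> \<Gamma>. wf_fm \<psi> \<Longrightarrow> qfree \<psi> \<Longrightarrow> nd T \<Gamma> (Or \<psi> (Neg \<psi>))"
  shows "wf_fm \<phi> \<Longrightarrow> qfree \<phi> \<Longrightarrow> implies_ntrans T \<phi> \<and> ntrans_implies_dn T \<phi>"
proof (induction \<phi>)
  case (Eq s t)
  show ?case
    unfolding implies_ntrans_def ntrans_implies_dn_def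
  proof (intro conjI allI impI)
    fix R \<Gamma>
    assume "nd T \<Gamma> (ntrans R (Eq s t))" and *: "nd T (insert (Eq s t) \<Gamma>) R"
    then have "nd T \<Gamma> (dn R (Eq s t))" by simp
    then show "nd T \<Gamma> R" using ImpI[OF * Eq.prems(1)] by (rule ImpE)
  qed (auto intro: nd_dnI)
next
  case Fls
  show ?case
    unfolding implies_ntrans_def ntrans_implies_dn_def by (simp add: FlsE)
next
  case (And \<phi> \<psi>)
  then have IH: "implies_ntrans T \<phi>" "ntrans_implies_dn T \<phi>"
      "implies_ntrans T \<psi>" "ntrans_implies_dn T \<psi>" and wf: "wf_fm \<phi>" "wf_fm \<psi>" by auto
  show ?case
    unfolding implies_ntrans_def ntrans_implies_dn_def
  proof (intro conjI allI impI)
    fix R \<Gamma>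
    assume R: "wf_fm R" and *: "nd T \<Gamma> (And \<phi> \<psi>)"
    show "nd T \<Gamma> (ntrans R (And \<phi> \<psi>))"
      using implies_ntransD[OF IH(1) R AndE1[OF *]] implies_ntransD[OF IH(3) R AndE2[OF *]]
      by (auto intro: AndI)
  next
    fix R \<Gamma>
    assume "nd T \<Gamma> (ntrans R (And \<phi> \<psi>))" and R: "nd T (insert (And \<phi> \<psi>) \<Gamma>) R"
    then have *: "nd T \<Gamma> (And (ntrans R \<phi>) (ntrans R \<psi>))" by simp
    show "nd T \<Gamma> R"
    proof (rule ntrans_implies_dnD[OF IH(2) AndE1[OF *]],
        rule ntrans_implies_dnD[OF IH(4) nd_weaken[OF AndE2[OF *]]])
      show "nd T (insert \<psi> (insert \<phi> \<Gamma>)) R"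
      proof (rule nd_cut)
        show "nd T (insert \<psi> (insert \<phi> \<Gamma>)) (And \<phi> \<psi>)"
          using wf by (intro AndI Hyp) auto
      qed (rule nd_weaken[OF R], auto)
    qed auto
  qed
next
  case (Or \<phi> \<psi>)
  then have IH: "implies_ntrans T \<phi>" "ntrans_implies_dn T \<phi>"
      "implies_ntrans T \<psi>" "ntrans_implies_dn T \<psi>" and wf: "wf_fm \<phi>" "wf_fm \<psi>" by auto
  show ?case
    unfolding implies_ntrans_def ntrans_implies_dn_def
  proof (intro conjI allI impI)
    fix R \<Gamma>
    assume R: "wf_fm R" and *: "nd T \<Gamma> (Or \<phi> \<psi>)"
    have "nd T (insert \<phi> \<Gamma>) (ntrans R \<phi>)" "nd T (insert \<psi> \<Gamma>) (ntrans R \<psi>)"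
      by (rule implies_ntransD[OF IH(1) R Hyp] implies_ntransD[OF IH(3) R Hyp], use wf in auto)+
    then have "nd T \<Gamma> (Or (ntrans R \<phi>) (ntrans R \<psi>))"
      by (intro OrE[OF *]) (use wf R in \<open>auto intro: OrI1 OrI2\<close>)
    then show "nd T \<Gamma> (ntrans R (Or \<phi> \<psi>))" using R by (auto intro: nd_dnI)
  next
    fix R \<Gamma>
    let ?A = "ntrans R \<phi>" and ?B = "ntrans R \<psi>"
    assume "nd T \<Gamma> (ntrans R (Or \<phi> \<psi>))" and R: "nd T (insert (Or \<phi> \<psi>) \<Gamma>) R"
    then have *: "nd T \<Gamma> (dn R (Or ?A ?B))" by simp
    have wfR: "wf_fm R" using R by (rule nd_wf)
    let ?G = "insert (Or ?A ?B) \<Gamma>"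
    have "nd T ?G R"
    proof (rule OrE[of _ _ ?A ?B])
      show "nd T ?G (Or ?A ?B)" using wf wfR by (auto intro: Hyp)
      show "nd T (insert ?A ?G) R"
      proof (rule ntrans_implies_dnD[OF IH(2)])
        show "nd T (insert ?A ?G) ?A" using wf wfR by (auto intro: Hyp)
        show "nd T (insert \<phi> (insert ?A ?G)) R"
          by (rule nd_cut[of _ _ "Or \<phi> \<psi>"])
            (use wf in \<open>auto intro: OrI1 Hyp nd_weaken[OF R]\<close>)
      qed
      show "nd T (insert ?B ?G) R"
      proof (rule ntrans_implies_dnD[OF IH(4)])
        show "nd T (insert ?B ?G) ?B" using wf wfR by (auto intro: Hyp)
        show "nd T (insert \<psi> (insert ?B ?G)) R"
          by (rule nd_cut[of _ _ "Or \<phi> \<psi>"])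
            (use wf in \<open>auto intro: OrI2 Hyp nd_weaken[OF R]\<close>)
      qed
    qed
    then have "nd T \<Gamma> (Imp (Or ?A ?B) R)" using wf wfR by (auto intro: ImpI)
    with * show "nd T \<Gamma> R" by (rule ImpE)
  qed
next
  case (Imp \<phi> \<psi>)
  then have IH: "implies_ntrans T \<phi>" "ntrans_implies_dn T \<phi>"
      "implies_ntrans T \<psi>" "ntrans_implies_dn T \<psi>" and wf: "wf_fm \<phi>" "wf_fm \<psi>" by auto
  \<comment> \<open>Both directions split on the antecedent. When it is refuted, its translation
    yields \<open>R\<close> and hence any translation; in the other direction the implication then
    holds by ex falso.\<close>
  have dec: "nd T \<Gamma> (Or \<phi> (Neg \<phi>))" for \<Gamma> using assms Imp.prems by auto
  show ?case
    unfolding implies_ntrans_def ntrans_implies_dn_def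
  proof (intro conjI allI impI)
    fix R \<Gamma>
    assume R: "wf_fm R" and *: "nd T \<Gamma> (Imp \<phi> \<psi>)"
    let ?A = "ntrans R \<phi>" and ?B = "ntrans R \<psi>"
    let ?G = "insert ?A \<Gamma>"
    have "nd T ?G ?B"
    proof (rule OrE[OF dec])
      have "nd T (insert \<phi> ?G) (Imp \<phi> \<psi>)" by (rule nd_weaken[OF *]) auto
      then have "nd T (insert \<phi> ?G) \<psi>" by (rule ImpE) (use wf in \<open>auto intro: Hyp\<close>)
      then show "nd T (insert \<phi> ?G) ?B" by (rule implies_ntransD[OF IH(3) R])
      have "nd T (insert (Neg \<phi>) ?G) R"
      proof (rule ntrans_implies_dnD[OF IH(2)])
        show "nd T (insert (Neg \<phi>) ?G) ?A" using wf R by (auto intro: Hyp)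
        have "nd T (insert \<phi> (insert (Neg \<phi>) ?G)) Fls"
          by (rule HypE[of \<phi>]) (use wf in \<open>auto intro: Hyp\<close>)
        then show "nd T (insert \<phi> (insert (Neg \<phi>) ?G)) R" using R by (rule FlsE)
      qed
      then show "nd T (insert (Neg \<phi>) ?G) ?B" using wf(2) by (rule ntrans_efq)
    qed
    then show "nd T \<Gamma> (ntrans R (Imp \<phi> \<psi>))" using wf R by (auto intro: ImpI)
  next
    fix R \<Gamma>
    let ?A = "ntrans R \<phi>" and ?B = "ntrans R \<psi>"
    assume "nd T \<Gamma> (ntrans R (Imp \<phi> \<psi>))" and R: "nd T (insert (Imp \<phi> \<psi>) \<Gamma>) R"
    then have *: "nd T \<Gamma> (Imp ?A ?B)" by simp
    have wfR: "wf_fm R" using R by (rule nd_wf)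
    show "nd T \<Gamma> R"
    proof (rule OrE[OF dec])
      have "nd T (insert \<phi> \<Gamma>) (Imp ?A ?B)" by (rule nd_weaken[OF *]) auto
      moreover have "nd T (insert \<phi> \<Gamma>) ?A"
        by (rule implies_ntransD[OF IH(1) wfR Hyp]) (use wf in auto)
      ultimately have "nd T (insert \<phi> \<Gamma>) ?B" by (rule ImpE)
      then show "nd T (insert \<phi> \<Gamma>) R"
      proof (rule ntrans_implies_dnD[OF IH(4)])
        show "nd T (insert \<psi> (insert \<phi> \<Gamma>)) R"
          by (rule nd_cut[of _ _ "Imp \<phi> \<psi>"])
            (use wf in \<open>auto intro: ImpI Hyp nd_weaken[OF R]\<close>)
      qed
      have "nd T (insert \<phi> (insert (Neg \<phi>) \<Gamma>)) Fls"
        by (rule HypE[of \<phi>]) (use wf in \<open>auto intro: Hyp\<close>)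
      then have "nd T (insert (Neg \<phi>) \<Gamma>) (Imp \<phi> \<psi>)"
        by (rule ImpI[OF FlsE]) (use wf in auto)
      then show "nd T (insert (Neg \<phi>) \<Gamma>) R"
        by (rule nd_cut) (rule nd_weaken[OF R], auto)
    qed
  qed
qed auto

lemma implies_ntrans_All:
  assumes "wf_fm \<phi>" "implies_ntrans T \<phi>"
  shows "implies_ntrans T (All \<phi>)"
  unfolding implies_ntrans_def
proof (intro allI impI)
  fix R \<Gamma>
  assume R: "wf_fm R" and *: "nd T \<Gamma> (All \<phi>)"
  have "nd T (lift ` insert (All \<phi>) \<Gamma>) \<phi>"
    by (rule nd_AllE0, rule Hyp) (use assms wf_lift[of "All \<phi>"] in auto)
  then have "nd T (lift ` insert (All \<phi>) \<Gamma>) (ntrans (lift R) \<phi>)"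
    by (rule implies_ntransD[OF assms(2), rotated]) (use R in simp)
  then have "nd T (insert (All \<phi>) \<Gamma>) (ntrans R (All \<phi>))"
    by (simp add: AllI)
  with * show "nd T \<Gamma> (ntrans R (All \<phi>))" by (rule nd_cut)
qed

lemma implies_ntrans_Ex:
  assumes "wf_fm \<phi>" "implies_ntrans T \<phi>"
  shows "implies_ntrans T (Ex \<phi>)"
  unfolding implies_ntrans_def
proof (intro allI impI)
  fix R \<Gamma>
  assume R: "wf_fm R" and *: "nd T \<Gamma> (Ex \<phi>)"
  have "nd T (insert \<phi> (lift ` \<Gamma>)) (ntrans (lift R) \<phi>)"
    by (rule implies_ntransD[OF assms(2) _ Hyp]) (use assms R in auto)
  then have "nd T (insert \<phi> (lift ` \<Gamma>)) (lift (Ex (ntrans (lift R) \<phi>)))"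
    by (rule nd_ExI0)
  with * have "nd T \<Gamma> (Ex (ntrans (lift R) \<phi>))"
    by (rule ExE) (use assms R in auto)
  then show "nd T \<Gamma> (ntrans R (Ex \<phi>))" using R by (simp add: nd_dnI)
qed

text \<open>As the goal is \<open>R\<close>, the double negation around the translated existential
  can be opened. At its witness, and for the same reason, \<open>\<phi>\<close> itself may be
  assumed, which gives \<open>Ex \<phi>\<close>.\<close>

lemma ntrans_implies_dn_Ex:
  assumes "wf_fm \<phi>" "ntrans_implies_dn T \<phi>"
  shows "ntrans_implies_dn T (Ex \<phi>)"
  unfolding ntrans_implies_dn_def
proof (intro allI impI)
  fix R \<Gamma>
  let ?A = "ntrans (lift R) \<phi>"
  assume "nd T \<Gamma> (ntrans R (Ex \<phi>))" and R: "nd T (insert (Ex \<phi>) \<Gamma>) R"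
  then have *: "nd T \<Gamma> (dn R (Ex ?A))" by simp
  have wfR: "wf_fm R" using R by (rule nd_wf)
  \<comment> \<open>The derivation of \<open>R\<close> from \<open>Ex \<phi>\<close> is kept as an
    implication among the hypotheses, so that it is lifted with them below the eigenvariable; a
    final cut discharges it.\<close>
  let ?G = "insert (Imp (Ex \<phi>) R) \<Gamma>"
  let ?H = "insert ?A (lift ` insert (Ex ?A) ?G)"
  have "nd T (insert \<phi> ?H) (lift (Ex \<phi>))"
    by (intro nd_ExI0 Hyp) (use assms in auto)
  then have "nd T (insert \<phi> ?H) (lift R)"
    by (rule HypE[rotated]) (use wfR in auto)
  moreover have "nd T ?H ?A" using assms wfR by (auto intro: Hyp)
  ultimately have body: "nd T ?H (lift R)" using ntrans_implies_dnD[OF assms(2)] by blast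
  have "nd T (insert (Ex ?A) ?G) (Ex ?A)" using assms wfR by (auto intro: Hyp)
  then have "nd T (insert (Ex ?A) ?G) R" using body wfR by (rule ExE)
  then have "nd T ?G (Imp (Ex ?A) R)" by (rule ImpI) (use assms wfR in simp)
  moreover have "nd T ?G (dn R (Ex ?A))" by (rule nd_weaken[OF *]) auto
  ultimately have "nd T ?G R" by (rule ImpE[rotated])
  moreover have "nd T \<Gamma> (Imp (Ex \<phi>) R)" using R by (rule ImpI) (use assms in simp)
  ultimately show "nd T \<Gamma> R" by (rule nd_cut[rotated])
qed

text \<open>\<open>All\<close> need not commute with double negation, so the formula is decided
  first. If the dual holds, take a counterexample: the translated body there allows the body itself
  to be assumed, which contradicts its dual and yields \<open>R\<close>.\<close>

lemma ntrans_implies_dn_All: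
  assumes "wf_fm \<phi>" "ntrans_implies_dn T \<phi>" "\<And>\<Gamma>. nd T \<Gamma> (Or (All \<phi>) (dual (All \<phi>)))"
  shows "ntrans_implies_dn T (All \<phi>)"
  unfolding ntrans_implies_dn_def
proof (intro allI impI)
  fix R \<Gamma>
  let ?A = "ntrans (lift R) \<phi>"
  assume "nd T \<Gamma> (ntrans R (All \<phi>))" and R: "nd T (insert (All \<phi>) \<Gamma>) R"
  then have *: "nd T \<Gamma> (All ?A)" by simp
  have wfR: "wf_fm R" using R by (rule nd_wf)
  show "nd T \<Gamma> R"
  proof (rule OrE[OF assms(3)])
    show "nd T (insert (All \<phi>) \<Gamma>) R" by (rule R)
    let ?G = "insert (All ?A) (insert (dual (All \<phi>)) \<Gamma>)"
    let ?H = "insert (dual \<phi>) (lift ` ?G)"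
    have body: "nd T ?H (lift R)"
    proof (rule ntrans_implies_dnD[OF assms(2)])
      show "nd T ?H ?A"
        by (rule nd_AllE0, rule Hyp) (use assms wfR wf_lift[of "All ?A"] in auto)
      show "nd T (insert \<phi> ?H) (lift R)"
        by (rule nd_dualE[of _ _ \<phi>]; (rule Hyp)?) (use assms wfR in auto)
    qed
    have "nd T ?G (Ex (dual \<phi>))" using assms(1) by (auto intro: Hyp)
    then have "nd T ?G R" using body wfR by (rule ExE)
    moreover have "nd T (insert (dual (All \<phi>)) \<Gamma>) (All ?A)" by (rule nd_weaken[OF *]) auto
    ultimately show "nd T (insert (dual (All \<phi>)) \<Gamma>) R" by (rule nd_cut[rotated])
  qed
qed

section \<open>Comparison under excluded middle for \<open>\<Sigma>_cls k\<close>\<close>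

context
  fixes k :: nat and T :: "fm set"
  assumes LEM: "LEM (\<Sigma>_cls k) \<subseteq> T"
begin

lemma qfree_LEM: "wf_fm \<psi> \<Longrightarrow> qfree \<psi> \<Longrightarrow> nd T \<Gamma> (Or \<psi> (Neg \<psi>))"
  using dual_LEM[OF LEM, of 0 \<psi> \<Gamma>] by (simp add: dual_qfree)

lemma prenex_implies_ntrans:
  assumes "prenex \<phi>"
  shows "implies_ntrans T \<phi>"
proof -
  obtain j where "\<phi> \<in> \<Sigma>_cls j \<union> \<Pi>_cls j" using assms by (auto simp: prenex_def)
  then show ?thesis
    by (induction rule: cls_induct)
      (use qfree_ntrans[OF qfree_LEM] implies_ntrans_All implies_ntrans_Ex in blast)+
qed

lemma cls_ntrans_implies_dn:
  "j \<le> k \<Longrightarrow> \<phi> \<in> \<Sigma>_cls j \<union> \<Pi>_cls j \<Longrightarrow> ntrans_implies_dn T \<phi>"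
proof (induction j arbitrary: \<phi>)
  case 0
  then show ?case using qfree_ntrans[OF qfree_LEM] by auto
next
  case (Suc j)
  from Suc.prems(2) consider
    (Ex) n \<psi> where "\<phi> = (Ex ^^ n) \<psi>" "\<psi> \<in> \<Pi>_cls j"
  | (All) n \<psi> where "\<phi> = (All ^^ n) \<psi>" "\<psi> \<in> \<Sigma>_cls j"
    by auto
  then show ?case
  proof cases
    case Ex
    have \<psi>: "wf_fm \<psi>" "ntrans_implies_dn T \<psi>"
      using Ex(2) cls_wf Suc.IH[of \<psi>] Suc.prems(1) by auto
    have "ntrans_implies_dn T ((Ex ^^ n) \<psi>)"
      by (induction n) (use \<psi> in \<open>auto intro: ntrans_implies_dn_Ex\<close>)
    then show ?thesis using Ex by simp
  next
    case All
    have \<psi>: "wf_fm \<psi>" "ntrans_implies_dn T \<psi>"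
      using All(2) cls_wf Suc.IH[of \<psi>] Suc.prems(1) by auto
    have "ntrans_implies_dn T ((All ^^ n) \<psi>)"
    proof (induction n)
      case (Suc n)
      \<comment> \<open>Every partial universal block lies in \<open>\<Pi>_cls (Suc j)\<close>, and
        \<open>Suc j \<le> k\<close> puts it within reach of \<open>dual_LEM\<close>.\<close>
      have "(All ^^ Suc n) \<psi> \<in> \<Pi>_cls (Suc j)" using All(2) unfolding \<Pi>_cls.simps by blast
      then have "nd T \<Gamma> (Or ((All ^^ Suc n) \<psi>) (dual ((All ^^ Suc n) \<psi>)))" for \<Gamma>
        using \<open>Suc j \<le> k\<close> by (intro dual_LEM[OF LEM]) auto
      then show ?case using ntrans_implies_dn_All[OF _ Suc.IH] \<psi> by simp
    qed (use \<psi> in simp)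
    then show ?thesis using All by simp
  qed
qed

end

section \<open>Conservativity\<close>

theorem PA_\<Sigma>_conservative:
  assumes "\<chi> \<in> \<Sigma>_cls (Suc k)" "prenex \<psi>" "PA \<turnstile> Imp \<psi> \<chi>"
  shows "HA \<union> LEM (\<Sigma>_cls k) \<turnstile> Imp \<psi> \<chi>"
proof -
  let ?T = "HA \<union> LEM (\<Sigma>_cls k)"
  obtain m \<theta> where \<chi>: "\<chi> = (Ex ^^ m) \<theta>" and \<theta>: "\<theta> \<in> \<Pi>_cls k" using assms(1) by auto
  have wf: "wf_fm \<psi>" "wf_fm \<chi>" "wf_fm \<theta>" using nd_wf[OF assms(3)] \<chi> by auto
  \<comment> \<open>The conclusion \<open>\<chi>\<close> itself serves as \<open>R\<close>.\<close>
  have "nd HA {} (ntrans \<chi> (Imp \<psi> \<chi>))"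
    using ntrans_sound[OF assms(3) wf(2)] by simp
  then have "nd ?T {} (Imp (ntrans \<chi> \<psi>) (ntrans \<chi> \<chi>))"
    using nd_mono by fastforce
  then have "nd ?T {\<psi>} (Imp (ntrans \<chi> \<psi>) (ntrans \<chi> \<chi>))"
    by (rule nd_weaken) simp
  moreover have "nd ?T {\<psi>} (ntrans \<chi> \<psi>)"
    by (rule implies_ntransD[OF prenex_implies_ntrans[OF _ assms(2)] wf(2) Hyp]) (use wf in auto)
  ultimately have *: "nd ?T {\<psi>} (ntrans \<chi> \<chi>)" by (rule ImpE)
  have "ntrans_implies_dn ?T \<theta>"
    using \<theta> by (intro cls_ntrans_implies_dn[of k _ k]) auto
  \<comment> \<open>The outer existential block costs no further excluded middle, so
    \<open>LEM\<close> at level \<open>k\<close> reaches conclusions in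
    \<open>\<Sigma>_cls (Suc k)\<close>.\<close>
  then have "ntrans_implies_dn ?T \<chi>"
    unfolding \<chi> using wf(3) by (induction m) (auto intro: ntrans_implies_dn_Ex)
  \<comment> \<open>With \<open>R\<close> equal to \<open>\<chi>\<close>, the remaining premise
    derives \<open>\<chi>\<close> from itself.\<close>
  then have "nd ?T {\<psi>} \<chi>"
    using * by (rule ntrans_implies_dnD) (use wf in \<open>auto intro: Hyp\<close>)
  then show ?thesis using wf(1) by (rule ImpI)
qed

theorem theorem6p14:
  fixes k :: nat and \<phi> \<psi> :: fm
  assumes "\<phi> \<in> \<Pi>_cls (k + 2)"
    and "prenex \<psi>"
    and "PA \<turnstile> Imp \<psi> \<phi>"
  shows "HA \<union> LEM (\<Sigma>_cls k) \<turnstile> Imp \<psi> \<phi>"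
proof -
  obtain n \<chi> where \<phi>: "\<phi> = (All ^^ n) \<chi>" and \<chi>: "\<chi> \<in> \<Sigma>_cls (Suc k)"
    using assms(1) by auto
  \<comment> \<open>The free variables of \<open>\<psi>\<close> are shifted past the
    \<open>n\<close> variables that become free when the universal block of \<open>\<phi>\<close> is
    opened.\<close>
  let ?s = "\<lambda>i. Var (i + n)"
  have wf: "wf_fm \<psi>" "wf_fm (subst ?s \<psi>)" using nd_wf[OF assms(3)] by (auto intro: wf_subst)
  have "PA \<turnstile> subst ?s (Imp \<psi> \<phi>)" using assms(3) by (rule nd_subst) simp
  then have "nd PA {subst ?s \<psi>} (Imp (subst ?s \<psi>) (subst ?s \<phi>))"
    using nd_weaken_empty by simp
  then have "nd PA {subst ?s \<psi>} (subst ?s \<phi>)"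
    by (rule ImpE) (use wf in \<open>auto intro: Hyp\<close>)
  \<comment> \<open>The block is instantiated at its own variables: \<open>\<tau>\<close> is
    \<open>Var\<close>, and \<open>Var (i + n)\<close> is \<open>?s i\<close>.\<close>
  then have "nd PA {subst ?s \<psi>} (subst Var \<chi>)"
    unfolding \<phi> by (rule nd_AllE_pow) auto
  then have "PA \<turnstile> Imp (subst ?s \<psi>) \<chi>" using wf by (auto intro: ImpI)
  then have "HA \<union> LEM (\<Sigma>_cls k) \<turnstile> Imp (subst ?s \<psi>) \<chi>"
    by (intro PA_\<Sigma>_conservative \<chi> prenex_subst assms(2)) auto
  then have "nd (HA \<union> LEM (\<Sigma>_cls k)) {subst ?s \<psi>} (Imp (subst ?s \<psi>) \<chi>)"
    by (rule nd_weaken_empty)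
  then have "nd (HA \<union> LEM (\<Sigma>_cls k)) {subst ?s \<psi>} \<chi>"
    by (rule ImpE) (use wf in \<open>auto intro: Hyp\<close>)
  \<comment> \<open>\<open>?s\<close> is \<open>n\<close>-fold lifting, so the shifted hypothesis is
    exactly what generalising over the block asks for.\<close>
  then have "nd (HA \<union> LEM (\<Sigma>_cls k)) {\<psi>} \<phi>"
    unfolding \<phi> by (intro nd_AllI_pow) (simp add: lift_pow)
  then show ?thesis using wf(1) by (rule ImpI)
qed

end
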